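(* Let $U_n$, $n\ge0$, be simply connected domains, let $f_n:U_{n-1}\to U_n$, $n\in\mathbb{N}$, be a sequence of holomorphic maps, each with a full radial extension, and let $F_n:U_0\to U_n$ be defined by \[ F_n=f_n\circ\cdots\circ f_1,\quad n\in\mathbb{N}, \] with the additional assumption that, for each $n\in\mathbb{N}$, \[ f_n(\zeta)\in\partial U_n\quad\text{for almost all }\zeta\in\partial U_{n-1} \] (with respect to harmonic measure). If $(F_n)$ is contracting and interior orbits converge to the boundary, then the Denjoy--Wolff set of $(F_n)$ has either full or zero harmonic measure with respect to $U_0$.
   Context: Simply connected domains are always assumed to be proper subsets of $\mathbb{C}$. $\operatorname{dist}$ is Euclidean distance and $\operatorname{dist}_U$ is hyperbolic distance in $U$. $\mathbb{D}$ is the unit disc. The sequence $F_n:U_0\to U_n$ is contracting if $\operatorname{dist}_{U_n}(F_n(z),F_n(z'))\to0$ as $n\to\infty$ for all $z,z'\in U_0$. Interior orbits converge to the boundary means $\operatorname{dist}(F_n(z),\partial U_n)\to0$ as $n\to\infty$ for all $z\in U_0$. Harmonic measure. For a simply connected domain $U$, $z\in U$ and a conformal map $\varphi:\mathbb{D}\to U$ (onto) with $\varphi(0)=z$, the harmonic measure of a Borel set $A\subset\partial U$ is $\omega(z,A,U)=\lambda((\varphi^* )^{-1}(A))$, where $\lambda$ is normalised Lebesgue measure on $\partial\mathbb{D}$ and $\varphi^*(\xi)=\lim_{r\to1^-}\varphi(r\xi)$ at the points $\xi\in\partial\mathbb{D}$ where this radial limit exists and is finite. Sets of zero/full harmonic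 measure do not depend on $z$. Radial extensions. A point $p\in\partial U$ is accessible from $U$ if there is an arc $\gamma:[0,1)\to U$ with $\gamma(t)\to p$ as $t\to1$; $\operatorname{AP}(U)$ is the set of such points. Let $f:U\to V$ be a holomorphic map between simply connected domains, $p\in\operatorname{AP}(U)$, and $\phi:\mathbb{D}\to U$ a Riemann map. A curve in $U$ approaches $p$ radially if it converges to $p$ and is the image under $\phi$ of a curve in $\mathbb{D}$ that approaches a point of $\partial\mathbb{D}$ nontangentially. $f$ has a radial extension to $p$ with value $f^*(p)$ if for every arc $\gamma(t)$, $t\in[0,1)$, in $U$ such that $\gamma(t)\to p$ radially as $t\to1$, we have $f(\gamma(t))\to f^*(p)$ as $t\to1$. $f$ has a full radial extension (to $\partial U$) if the domain of $f^*$ includes a subset of $\operatorname{AP}(U)$ of full harmonic measure with respect to $U$. The extension is again denoted by $f$. A composition of maps with full radial extensions has a full radial extension, given by the composition of the extensions. Denjoy--Wolff set. When interior orbits converge to the boundary, the Denjoy--Wolff set of $(F_n)$ is the set of $\zeta\in\partial U_0$ (at which the extensions $F_n(\zeta)$ are defined) such that, for all $z\in U_0$, $|F_n(\zeta)-F_n(z)|\to0$ as $n\to\infty$. *)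

theory Defs
  imports "HOL-Complex_Analysis.Complex_Analysis" "HOL-Probability.Probability"
begin

definition simply_connected_domain :: "complex set \<Rightarrow> bool" where
  "simply_connected_domain U \<longleftrightarrow>
     open U \<and> simply_connected U \<and> U \<noteq> {} \<and> U \<noteq> UNIV"

definition riemann_map :: "complex set \<Rightarrow> (complex \<Rightarrow> complex) \<Rightarrow> bool" where
  "riemann_map U \<phi> \<longleftrightarrow> \<phi> holomorphic_on ball 0 1 \<and> bij_betw \<phi> (ball 0 1) U"

text \<open>
  Hyperbolic distance for the metric of curvature \<open>-1\<close>. The distance in \<open>U\<close> does not depend
  on the Riemann map chosen, since automorphisms of the disc are hyperbolic isometries.
\<close>

definition hyp_dist_disc :: "complex \<Rightarrow> complex \<Rightarrow> real" where
  "hyp_dist_disc a b = 2 * artanh (cmod ((a - b) / (1 - cnj b * a)))"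

definition hyp_dist :: "complex set \<Rightarrow> complex \<Rightarrow> complex \<Rightarrow> real" where
  "hyp_dist U z w =
     (let \<phi> = (SOME \<phi>. riemann_map U \<phi>)
      in hyp_dist_disc (inv_into (ball 0 1) \<phi> z) (inv_into (ball 0 1) \<phi> w))"

text \<open>
  Normalised Lebesgue measure on the unit circle, as a complete measure on the plane.
\<close>

definition circle_measure :: "complex measure" where
  "circle_measure = completion (distr (uniform_measure lborel {0..2 * pi}) borel cis)"

definition has_radial_limit :: "(complex \<Rightarrow> complex) \<Rightarrow> complex \<Rightarrow> complex \<Rightarrow> bool" where
  "has_radial_limit \<phi> \<xi> p \<longleftrightarrow> ((\<lambda>r. \<phi> (of_real r * \<xi>)) \<longlongrightarrow> p) (at_left 1)"

definition radial_preimage :: "(complex \<Rightarrow> complex) \<Rightarrow> complex set \<Rightarrow> complex set" where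
  "radial_preimage \<phi> A = {\<xi> \<in> sphere 0 1. \<exists>p\<in>A. has_radial_limit \<phi> \<xi> p}"

text \<open>
  The map chosen here is unique up to a rotation of the disc, under which
  \<^const>\<open>circle_measure\<close> is invariant.
\<close>

definition riemann_map_at :: "complex set \<Rightarrow> complex \<Rightarrow> complex \<Rightarrow> complex" where
  "riemann_map_at U z = (SOME \<phi>. riemann_map U \<phi> \<and> \<phi> 0 = z)"

definition harmonic_measure :: "complex \<Rightarrow> complex set \<Rightarrow> complex set \<Rightarrow> real" where
  "harmonic_measure z A U = measure circle_measure (radial_preimage (riemann_map_at U z) A)"

text \<open>
  \<^const>\<open>measure\<close> is \<open>0\<close> on non-measurable sets, so measurability is required separately.
  Because \<^const>\<open>circle_measure\<close> is complete, the two notions below are those for the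
  completion of harmonic measure on the Borel sets; the set \<open>A\<close> itself need not be Borel.
\<close>

definition harmonic_measurable :: "complex \<Rightarrow> complex set \<Rightarrow> complex set \<Rightarrow> bool" where
  "harmonic_measurable z A U \<longleftrightarrow>
     radial_preimage (riemann_map_at U z) A \<in> sets circle_measure"

definition full_harmonic_measure :: "complex set \<Rightarrow> complex set \<Rightarrow> bool" where
  "full_harmonic_measure U A \<longleftrightarrow>
     (\<forall>z\<in>U. harmonic_measurable z A U \<and> harmonic_measure z A U = 1)"

definition zero_harmonic_measure :: "complex set \<Rightarrow> complex set \<Rightarrow> bool" where
  "zero_harmonic_measure U A \<longleftrightarrow>
     (\<forall>z\<in>U. harmonic_measurable z A U \<and> harmonic_measure z A U = 0)"

text \<open>
  Arcs are parametrised by \<open>[0,1)\<close>; values of \<open>\<gamma>\<close> outside this interval are irrelevant.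
\<close>

definition half_open_arc_in :: "complex set \<Rightarrow> (real \<Rightarrow> complex) \<Rightarrow> bool" where
  "half_open_arc_in U \<gamma> \<longleftrightarrow>
     continuous_on {0..<1} \<gamma> \<and> inj_on \<gamma> {0..<1} \<and> \<gamma> ` {0..<1} \<subseteq> U"

definition accessible_points :: "complex set \<Rightarrow> complex set" where
  "accessible_points U =
     {p \<in> frontier U. \<exists>\<gamma>. half_open_arc_in U \<gamma> \<and> (\<gamma> \<longlongrightarrow> p) (at_left 1)}"

text \<open>
  The regions \<open>{z. cmod (z - \<xi>) \<le> M * (1 - cmod z)}\<close> are the Stolz regions at \<open>\<xi>\<close>.
\<close>

definition nontangential_approach :: "(real \<Rightarrow> complex) \<Rightarrow> complex \<Rightarrow> bool" where
  "nontangential_approach \<sigma> \<xi> \<longleftrightarrow>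
     continuous_on {0..<1} \<sigma> \<and> \<sigma> ` {0..<1} \<subseteq> ball 0 1 \<and> (\<sigma> \<longlongrightarrow> \<xi>) (at_left 1) \<and>
     (\<exists>M. \<forall>\<^sub>F t in at_left 1. cmod (\<sigma> t - \<xi>) \<le> M * (1 - cmod (\<sigma> t)))"

definition approaches_radially :: "complex set \<Rightarrow> (real \<Rightarrow> complex) \<Rightarrow> complex \<Rightarrow> bool" where
  "approaches_radially U \<gamma> p \<longleftrightarrow>
     (\<gamma> \<longlongrightarrow> p) (at_left 1) \<and>
     (\<exists>\<phi> \<sigma> \<xi>. riemann_map U \<phi> \<and> \<xi> \<in> sphere 0 1 \<and> nontangential_approach \<sigma> \<xi> \<and>
        (\<forall>t\<in>{0..<1}. \<gamma> t = \<phi> (\<sigma> t)))"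

definition has_radial_extension ::
  "complex set \<Rightarrow> (complex \<Rightarrow> complex) \<Rightarrow> complex \<Rightarrow> complex \<Rightarrow> bool" where
  "has_radial_extension U f p w \<longleftrightarrow>
     p \<in> accessible_points U \<and>
     (\<forall>\<gamma>. half_open_arc_in U \<gamma> \<and> approaches_radially U \<gamma> p \<longrightarrow>
        ((\<lambda>t. f (\<gamma> t)) \<longlongrightarrow> w) (at_left 1))"

definition full_radial_extension :: "complex set \<Rightarrow> (complex \<Rightarrow> complex) \<Rightarrow> bool" where
  "full_radial_extension U f \<longleftrightarrow>
     (\<exists>A \<subseteq> accessible_points U. full_harmonic_measure U A \<and>
        (\<forall>p\<in>A. \<exists>w. has_radial_extension U f p w))"

text \<open>
  The map \<open>f\<close> together with its radial extension, as a relation between points and values.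
\<close>

definition extended_value ::
  "complex set \<Rightarrow> (complex \<Rightarrow> complex) \<Rightarrow> complex \<Rightarrow> complex \<Rightarrow> bool" where
  "extended_value U f p w \<longleftrightarrow> p \<in> U \<and> w = f p \<or> has_radial_extension U f p w"

text \<open>
  The sequence of maps is indexed from \<open>1\<close>: \<open>f (Suc n)\<close> maps \<open>U n\<close> to \<open>U (Suc n)\<close>, and
  \<open>f 0\<close> plays no role.
\<close>

primrec comp_seq :: "(nat \<Rightarrow> complex \<Rightarrow> complex) \<Rightarrow> nat \<Rightarrow> complex \<Rightarrow> complex" where
  "comp_seq f 0 = id"
| "comp_seq f (Suc n) = f (Suc n) \<circ> comp_seq f n"

text \<open>
  The extension of \<^term>\<open>comp_seq f n\<close> to boundary points is the composition of the
  extensions of the individual maps.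
\<close>

primrec comp_seq_extended_value ::
  "(nat \<Rightarrow> complex set) \<Rightarrow> (nat \<Rightarrow> complex \<Rightarrow> complex) \<Rightarrow> nat \<Rightarrow> complex \<Rightarrow> complex \<Rightarrow> bool"
where
  "comp_seq_extended_value U f 0 \<zeta> w \<longleftrightarrow> w = \<zeta>"
| "comp_seq_extended_value U f (Suc n) \<zeta> w \<longleftrightarrow>
     (\<exists>v. comp_seq_extended_value U f n \<zeta> v \<and> extended_value (U n) (f (Suc n)) v w)"

definition contracting :: "(nat \<Rightarrow> complex set) \<Rightarrow> (nat \<Rightarrow> complex \<Rightarrow> complex) \<Rightarrow> bool" where
  "contracting U F \<longleftrightarrow>
     (\<forall>z\<in>U 0. \<forall>z'\<in>U 0. (\<lambda>n. hyp_dist (U n) (F n z) (F n z')) \<longlonglongrightarrow> 0)"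

definition interior_orbits_converge_to_boundary ::
  "(nat \<Rightarrow> complex set) \<Rightarrow> (nat \<Rightarrow> complex \<Rightarrow> complex) \<Rightarrow> bool" where
  "interior_orbits_converge_to_boundary U F \<longleftrightarrow>
     (\<forall>z\<in>U 0. (\<lambda>n. infdist (F n z) (frontier (U n))) \<longlonglongrightarrow> 0)"

definition denjoy_wolff_set ::
  "(nat \<Rightarrow> complex set) \<Rightarrow> (nat \<Rightarrow> complex \<Rightarrow> complex) \<Rightarrow> complex set" where
  "denjoy_wolff_set U f =
     {\<zeta> \<in> frontier (U 0). \<exists>W. (\<forall>n. comp_seq_extended_value U f n \<zeta> (W n)) \<and>
        (\<forall>z\<in>U 0. (\<lambda>n. cmod (W n - comp_seq f n z)) \<longlonglongrightarrow> 0)}"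

end

theory Submission
  imports Defs
begin

text \<open>
  Let \<open>\<omega>\<^sub>n(z, A)\<close> be harmonic measure of \<open>U n\<close> seen from \<open>F\<^sub>n(z)\<close>. A point of \<open>\<partial> U\<^sub>0\<close> lies in the
  Denjoy--Wolff set \<open>D\<^sub>0\<close> iff its image in \<open>\<partial> U\<^sub>n\<close> lies in the corresponding set \<open>D\<^sub>n\<close> of the tail of
  the sequence, and the boundary maps preserve harmonic measure, so \<open>\<omega>\<^sub>0(z, D\<^sub>0) = \<omega>\<^sub>n(z, D\<^sub>n)\<close>.
  By contraction and Harnack's inequality \<open>\<omega>\<^sub>n(z, D\<^sub>n) - \<omega>\<^sub>n(z', D\<^sub>n)\<close> tends to \<open>0\<close>, so the harmonic
  function \<open>z \<mapsto> \<omega>\<^sub>0(z, D\<^sub>0)\<close> is constant. It has the boundary values of an indicator function, so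
  the constant is \<open>0\<close> or \<open>1\<close>.

  Invariance of harmonic measure under \<open>G : \<D> \<rightarrow> V\<close> with radial limits in \<open>\<partial> V\<close> needs neither
  Fatou's theorem nor Lindeloef's theorem: for Lipschitz boundary data \<open>T\<close> on \<open>\<partial> V\<close> the bounded
  harmonic extension \<open>u\<close> to \<open>V\<close> satisfies \<open>u(z) - T(z) \<rightarrow> 0\<close> as \<open>z \<rightarrow> \<partial> V\<close>, and averaging
  \<open>u \<circ> G\<close> over circles of radius tending to \<open>1\<close> gives the integral of \<open>T\<close> against both measures.
  The rate in this statement comes from univalence: if \<open>p\<close> is the frontier point nearest to
  \<open>\<phi>(w)\<close>, the square root of \<open>(\<phi> - p) / (\<phi>(w) - p)\<close> with value \<open>1\<close> at \<open>w\<close> omits a disc about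
  \<open>-1\<close> of fixed radius.
\<close>

subsection \<open>The Poisson integral\<close>

text \<open>The Borel measure underlying \<open>circle_measure\<close>. Product and image measures
  are formed with it, and the completion is taken only afterwards.\<close>

definition circ :: "complex measure" where
  "circ = distr (uniform_measure lborel {0..2 * pi}) borel cis"

lemma sets_circ [simp, measurable_cong]: "sets circ = sets borel"
  by (simp add: circ_def)

lemma space_circ [simp]: "space circ = UNIV"
  by (simp add: circ_def)

lemma cis_borel [measurable]: "cis \<in> borel_measurable borel"
  by (intro borel_measurable_continuous_onI continuous_intros)

lemma prob_space_circ: "prob_space circ"
  unfolding circ_def
  by (intro prob_space.prob_space_distr prob_space_uniform_measure)
    (auto simp: measurable_cong_sets[OF sets_uniform_measure refl])

interpretation circ: prob_space circ by (rule prob_space_circ)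

lemma circle_measure_eq: "circle_measure = completion circ"
  by (simp add: circle_measure_def circ_def)

lemma AE_circ_norm: "AE \<xi> in circ. cmod \<xi> = 1"
  unfolding circ_def by (subst AE_distr_iff) auto

text \<open>Cauchy's formula concerns gauge integrals over a parametrised circle, while Fubini and
  the convergence theorems concern Lebesgue integrals against \<open>circ\<close>. These facts
  connect the two.\<close>

lemma
  fixes g :: "complex \<Rightarrow> 'a::euclidean_space"
  assumes meas [measurable]: "g \<in> borel_measurable borel"
    and cont: "continuous_on (sphere 0 1) g"
  shows integrable_circ: "integrable circ g"
    and has_integral_circ:
      "((\<lambda>t. g (cis t)) has_integral (2 * pi) *\<^sub>R (\<integral>\<xi>. g \<xi> \<partial>circ)) {0..2 * pi}"
proof -
  have cc: "continuous_on {0..2 * pi} (\<lambda>t. g (cis t))"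
    by (intro continuous_on_compose2[OF cont] continuous_intros) auto
  have si: "set_integrable lborel {0..2 * pi} (\<lambda>t. g (cis t))"
    using borel_integrable_atLeastAtMost'[OF cc] .
  have dens: "uniform_measure lborel {0..2 * pi} =
      density lborel (\<lambda>t. ennreal (indicator {0..2 * pi} t / (2 * pi)))"
    unfolding uniform_measure_def
  proof (intro density_cong AE_I2)
    fix t :: real
    show "indicator {0..2 * pi} t / emeasure lborel {0..2 * pi} = ennreal (indicator {0..2 * pi} t / (2 * pi))"
      using divide_ennreal[of 1 "2 * pi"] by (cases "t \<in> {0..2 * pi}") auto
  qed auto
  have scale: "(indicator {0..2 * pi} t / (2 * pi)) *\<^sub>R g (cis t) =
      (1 / (2 * pi)) *\<^sub>R (indicator {0..2 * pi} t *\<^sub>R g (cis t))" for t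
    by (simp add: indicator_def)
  have "integrable (uniform_measure lborel {0..2 * pi}) (\<lambda>t. g (cis t))"
    unfolding dens using si
    by (subst integrable_density) (auto simp: set_integrable_def scale simp del: scaleR_scaleR)
  then show "integrable circ g"
    unfolding circ_def by (subst integrable_distr_eq) auto
  have "(\<integral>\<xi>. g \<xi> \<partial>circ) = (\<integral>t. g (cis t) \<partial>uniform_measure lborel {0..2 * pi})"
    unfolding circ_def by (subst integral_distr) auto
  also have "\<dots> = (\<integral>t. (indicator {0..2 * pi} t / (2 * pi)) *\<^sub>R g (cis t) \<partial>lborel)"
    unfolding dens by (subst integral_density) auto
  also have "\<dots> = (1 / (2 * pi)) *\<^sub>R (LINT t:{0..2 * pi}|lborel. g (cis t))"
    unfolding set_lebesgue_integral_def scale by (simp del: scaleR_scaleR)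
  finally have "(2 * pi) *\<^sub>R (\<integral>\<xi>. g \<xi> \<partial>circ) = (LINT t:{0..2 * pi}|lborel. g (cis t))"
    by simp
  then show "((\<lambda>t. g (cis t)) has_integral (2 * pi) *\<^sub>R (\<integral>\<xi>. g \<xi> \<partial>circ)) {0..2 * pi}"
    using set_borel_integral_eq_integral[OF si] by (simp add: has_integral_integral)
qed

definition poisson :: "complex \<Rightarrow> complex \<Rightarrow> real" where
  "poisson w \<xi> = (1 - (cmod w)\<^sup>2) / (cmod (\<xi> - w))\<^sup>2"

lemma poisson_borel [measurable]:
  "(\<lambda>x. poisson (f x) (g x)) \<in> borel_measurable M"
  if [measurable]: "f \<in> borel_measurable M" "g \<in> borel_measurable M"
  unfolding poisson_def by measurable

lemma poisson_0 [simp]: "cmod \<xi> = 1 \<Longrightarrow> poisson 0 \<xi> = 1"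
  by (simp add: poisson_def)

lemma poisson_nonneg: "cmod w < 1 \<Longrightarrow> 0 \<le> poisson w \<xi>"
  unfolding poisson_def by (intro divide_nonneg_nonneg) (auto simp: power_le_one)

text \<open>The first term is the Cauchy kernel times \<open>\<xi>\<close>; the second has no pole
  in the closed disc. Contour integration against a holomorphic function therefore sees the first
  term only.\<close>

lemma poisson_eq_cauchy:
  assumes "cmod w < 1" "cmod \<xi> = 1"
  shows "of_real (poisson w \<xi>) = \<xi> / (\<xi> - w) + cnj w * \<xi> / (1 - cnj w * \<xi>)"
proof -
  have nz: "\<xi> - w \<noteq> 0" "\<xi> \<noteq> 0" using assms by auto
  have cx: "cnj \<xi> * \<xi> = 1" using assms complex_norm_square[of \<xi>] by (simp add: mult.commute)
  have e: "1 - cnj w * \<xi> = \<xi> * cnj (\<xi> - w)"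
    using cx by (simp add: algebra_simps)
  have "of_real (poisson w \<xi>) = (1 - w * cnj w) / ((\<xi> - w) * cnj (\<xi> - w))"
    unfolding poisson_def by (simp add: of_real_power[symmetric] complex_norm_square del: of_real_power complex_cnj_diff)
  also have "\<dots> = \<xi> / (\<xi> - w) + cnj w * \<xi> / (1 - cnj w * \<xi>)"
    unfolding e using nz cx by (simp add: field_simps del: complex_cnj_diff) (simp add: algebra_simps)
  finally show ?thesis .
qed

text \<open>For fixed \<open>\<xi>\<close> the kernel is the real part of a function holomorphic in
  \<open>w\<close>. This form survives the substitution of a holomorphic self-map of the disc for
  \<open>w\<close>.\<close>

lemma poisson_eq_Re:
  assumes "cmod w < 1" "cmod \<xi> = 1"
  shows "poisson w \<xi> = Re ((\<xi> + w) / (\<xi> - w))"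
proof -
  have "Re ((\<xi> + w) / (\<xi> - w)) = Re ((\<xi> + w) * cnj (\<xi> - w)) / (cmod (\<xi> - w))\<^sup>2"
    by (metis Re_complex_div_eq_0 Re_divide_of_real complex_div_cnj of_real_power)
  also have "Re ((\<xi> + w) * cnj (\<xi> - w)) = 1 - (cmod w)\<^sup>2"
    using assms by (simp add: cmod_power2 algebra_simps power2_eq_square[of "Re _"] power2_eq_square[of "Im _"])
      (use assms(2) in \<open>simp add: cmod_def power2_eq_square\<close>)
  finally show ?thesis by (simp add: poisson_def)
qed

lemma poisson_le:
  assumes "cmod w < 1" "cmod \<xi> = 1"
  shows "poisson w \<xi> \<le> (1 + cmod w) / (1 - cmod w)"
    and "(1 - cmod w) / (1 + cmod w) \<le> poisson w \<xi>"
proof -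
  let ?a = "cmod w"
  have 1: "1 - ?a \<le> cmod (\<xi> - w)" using norm_triangle_ineq2[of \<xi> w] assms by simp
  have 2: "cmod (\<xi> - w) \<le> 1 + ?a" using norm_triangle_ineq4[of \<xi> w] assms by simp
  have p: "0 < 1 - ?a" "0 < 1 + ?a" "0 < cmod (\<xi> - w)" using assms 1 by (auto simp: add_pos_nonneg)
  have s: "1 - ?a\<^sup>2 = (1 - ?a) * (1 + ?a)" by (simp add: algebra_simps power2_eq_square)
  have "poisson w \<xi> \<le> (1 - ?a\<^sup>2) / (1 - ?a)\<^sup>2"
    unfolding poisson_def using 1 p s by (intro divide_left_mono power_mono mult_pos_pos) auto
  also have "\<dots> = (1 + ?a) / (1 - ?a)" unfolding s using p by (simp add: power2_eq_square)
  finally show "poisson w \<xi> \<le> (1 + cmod w) / (1 - cmod w)" .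
  have "(1 - ?a) / (1 + ?a) = (1 - ?a\<^sup>2) / (1 + ?a)\<^sup>2" unfolding s using p by (simp add: power2_eq_square)
  also have "\<dots> \<le> poisson w \<xi>"
    unfolding poisson_def using 2 p s by (intro divide_left_mono power_mono mult_pos_pos) auto
  finally show "(1 - cmod w) / (1 + cmod w) \<le> poisson w \<xi>" .
qed

text \<open>A quantitative Harnack inequality: it controls how harmonic measure changes when the
  pole moves from 0 to \<open>w\<close>.\<close>

lemma poisson_diff_1:
  assumes "cmod w < 1" "cmod \<xi> = 1"
  shows "\<bar>poisson w \<xi> - 1\<bar> \<le> 2 * cmod w / (1 - cmod w)"
proof -
  have p: "0 < 1 - cmod w" using assms by simp
  have "poisson w \<xi> - 1 \<le> 2 * cmod w / (1 - cmod w)"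
    using poisson_le(1)[OF assms] p by (simp add: field_simps)
  moreover have "1 - poisson w \<xi> \<le> 2 * cmod w / (1 + cmod w)"
    proof -
    have "1 - 2 * cmod w / (1 + cmod w) = (1 - cmod w) / (1 + cmod w)"
      using norm_ge_zero[of w] by (simp add: field_simps add_nonneg_eq_0_iff del: norm_ge_zero)
    then show ?thesis using poisson_le(2)[OF assms] by linarith
  qed
  moreover have "2 * cmod w / (1 + cmod w) \<le> 2 * cmod w / (1 - cmod w)"
    using p norm_ge_zero[of w] by (intro divide_left_mono mult_pos_pos) (auto simp del: norm_ge_zero)
  ultimately show ?thesis by linarith
qed

lemma continuous_on_poisson:
  assumes "cmod w < 1"
  shows "continuous_on (sphere 0 1) (poisson w)"
  unfolding poisson_def using assms by (intro continuous_intros) auto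

text \<open>Dilation by \<open>r < 1\<close> makes the integrand holomorphic on the closed disc.
  Cauchy's formula then evaluates the first term of \<open>poisson_eq_cauchy\<close>, and Cauchy's
  theorem annihilates the second.\<close>

lemma poisson_mean:
  fixes q :: "complex \<Rightarrow> complex" and r :: real
  assumes holo: "q holomorphic_on ball 0 1" and [measurable]: "q \<in> borel_measurable borel"
    and w: "cmod w < 1" and r: "0 \<le> r" "r < 1"
  shows "integrable circ (\<lambda>\<xi>. poisson w \<xi> *\<^sub>R q (of_real r * \<xi>))"
    and "(\<integral>\<xi>. poisson w \<xi> *\<^sub>R q (of_real r * \<xi>) \<partial>circ) = q (of_real r * w)"
proof -
  let ?g = "\<lambda>\<xi>. poisson w \<xi> *\<^sub>R q (of_real r * \<xi>)"
  have sub: "(\<lambda>\<xi>::complex. of_real r * \<xi>) ` cball 0 1 \<subseteq> ball 0 1"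
  proof (rule image_subsetI)
    fix \<xi> :: complex assume "\<xi> \<in> cball 0 1"
    then have "r * cmod \<xi> \<le> r * 1" using r by (intro mult_left_mono) auto
    then show "of_real r * \<xi> \<in> ball 0 1" using r by (simp add: norm_mult)
  qed
  have hq: "(\<lambda>\<xi>. q (of_real r * \<xi>)) holomorphic_on cball 0 1"
    using holomorphic_on_compose_gen[OF _ holo sub] by (simp add: o_def holomorphic_intros)
  have cq: "continuous_on (sphere 0 1) (\<lambda>\<xi>. q (of_real r * \<xi>))"
    using holomorphic_on_imp_continuous_on[OF hq] by (rule continuous_on_subset) auto
  have cg: "continuous_on (sphere 0 1) ?g"
    by (intro continuous_intros continuous_on_poisson w cq)
  show int: "integrable circ ?g"
    by (rule integrable_circ[OF _ cg]) measurable
  have nz: "1 - cnj w * u \<noteq> 0" if "cmod u \<le> 1" for u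
  proof
    assume "1 - cnj w * u = 0"
    then have "cmod w * cmod u = 1" by (metis complex_mod_cnj eq_iff_diff_eq_0 norm_mult norm_one)
    moreover have "cmod w * cmod u \<le> cmod w * 1" using that by (intro mult_left_mono) auto
    ultimately show False using w by simp
  qed
  have c1: "((\<lambda>u. q (of_real r * u) / (u - w)) has_contour_integral (2 * of_real pi * \<i> * q (of_real r * w)))
      (circlepath 0 1)"
    using Cauchy_integral_circlepath_simple[OF hq, of w] w by simp
  have "(\<lambda>u. q (of_real r * u) * cnj w / (1 - cnj w * u)) holomorphic_on cball 0 1"
    using nz by (intro holomorphic_intros hq) auto
  from Cauchy_theorem_convex_simple[OF this, of "circlepath 0 1"]
  have c2: "((\<lambda>u. q (of_real r * u) * cnj w / (1 - cnj w * u)) has_contour_integral 0) (circlepath 0 1)"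
    by auto
  have "((\<lambda>u. q (of_real r * u) / (u - w) + q (of_real r * u) * cnj w / (1 - cnj w * u))
      has_contour_integral (2 * of_real pi * \<i> * q (of_real r * w))) (part_circlepath 0 1 0 (2 * pi))"
    using has_contour_integral_add[OF c1 c2] by (simp add: circlepath_def)
  then have "((\<lambda>t. (q (of_real r * cis t) / (cis t - w) + q (of_real r * cis t) * cnj w / (1 - cnj w * cis t))
      * \<i> * cis t) has_integral (2 * of_real pi * \<i> * q (of_real r * w))) {0..2 * pi}"
    by (subst (asm) has_contour_integral_part_circlepath_iff) auto
  \<comment> \<open>The factor \<open>- \<i>\<close> cancels the \<open>\<i>\<close> in the
    derivative of \<open>cis\<close>; the remaining \<open>cis t\<close> supplies the numerators in
    \<open>poisson_eq_cauchy\<close>.\<close>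
  then have "((\<lambda>t. - \<i> * ((q (of_real r * cis t) / (cis t - w) + q (of_real r * cis t) * cnj w / (1 - cnj w * cis t))
      * \<i> * cis t)) has_integral (- \<i> * (2 * of_real pi * \<i> * q (of_real r * w)))) {0..2 * pi}"
    by (rule has_integral_mult_right)
  also have "(\<lambda>t. - \<i> * ((q (of_real r * cis t) / (cis t - w) + q (of_real r * cis t) * cnj w / (1 - cnj w * cis t))
      * \<i> * cis t)) = (\<lambda>t. ?g (cis t))"
    by (rule ext) (simp add: scaleR_conv_of_real poisson_eq_cauchy[OF w] algebra_simps)
  also have "- \<i> * (2 * of_real pi * \<i> * q (of_real r * w)) = (2 * pi) *\<^sub>R q (of_real r * w)"
    by (simp add: scaleR_conv_of_real algebra_simps)
  finally have "((\<lambda>t. ?g (cis t)) has_integral (2 * pi) *\<^sub>R q (of_real r * w)) {0..2 * pi}" .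
  moreover have "((\<lambda>t. ?g (cis t)) has_integral (2 * pi) *\<^sub>R (\<integral>\<xi>. ?g \<xi> \<partial>circ)) {0..2 * pi}"
    by (rule has_integral_circ[OF _ cg]) measurable
  ultimately show "(\<integral>\<xi>. ?g \<xi> \<partial>circ) = q (of_real r * w)"
    using has_integral_unique by (metis (no_types) pi_neq_zero mult_eq_0_iff scaleR_left_imp_eq zero_neq_numeral)
qed

lemma poisson_mean_Re:
  fixes q :: "complex \<Rightarrow> complex" and r :: real
  assumes "q holomorphic_on ball 0 1" "q \<in> borel_measurable borel"
    and "cmod w < 1" "0 \<le> r" "r < 1"
  shows "integrable circ (\<lambda>\<xi>. poisson w \<xi> * Re (q (of_real r * \<xi>)))"
    and "(\<integral>\<xi>. poisson w \<xi> * Re (q (of_real r * \<xi>)) \<partial>circ) = Re (q (of_real r * w))"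
  using integrable_Re[OF poisson_mean(1)[OF assms]] integral_Re[OF poisson_mean(1)[OF assms]]
  unfolding poisson_mean(2)[OF assms] by (simp_all only: scaleR_complex.sel)

lemma poisson_total:
  assumes "cmod w < 1"
  shows "integrable circ (poisson w)" "(\<integral>\<xi>. poisson w \<xi> \<partial>circ) = 1"
    and "(\<integral>\<^sup>+\<xi>. poisson w \<xi> \<partial>circ) = 1"
proof -
  show "integrable circ (poisson w)" "(\<integral>\<xi>. poisson w \<xi> \<partial>circ) = 1"
    using poisson_mean_Re[of "\<lambda>_. 1" w 0] assms by simp_all
  then show "(\<integral>\<^sup>+\<xi>. poisson w \<xi> \<partial>circ) = 1"
    using poisson_nonneg[OF assms] by (subst nn_integral_eq_integral) auto
qed

subsection \<open>Univalent maps near the frontier\<close>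

text \<open>Extension by 0 turns a function holomorphic on the disc into a Borel function on the
  whole plane, as integration against \<open>circ\<close> demands.\<close>

definition cut :: "(complex \<Rightarrow> complex) \<Rightarrow> complex \<Rightarrow> complex" where
  "cut \<phi> z = (if z \<in> ball 0 1 then \<phi> z else 0)"

lemma cut_eq [simp]: "cmod z < 1 \<Longrightarrow> cut \<phi> z = \<phi> z"
  by (simp add: cut_def)

lemma holomorphic_cut: "cut \<phi> holomorphic_on ball 0 1 \<longleftrightarrow> \<phi> holomorphic_on ball 0 1"
  by (rule holomorphic_cong) (auto simp: cut_def)

lemma borel_cut: "cut \<phi> \<in> borel_measurable borel" if "\<phi> holomorphic_on ball 0 1"
  unfolding cut_def using holomorphic_on_imp_continuous_on[OF that]
  by (intro borel_measurable_continuous_on_if) auto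

lemma bij_holomorphic_inverse:
  assumes holo: "f holomorphic_on S" and S: "open S" and bij: "bij_betw f S V"
  obtains g where "g holomorphic_on V" "\<And>z. z \<in> S \<Longrightarrow> g (f z) = z"
proof (rule holomorphic_has_inverse[OF holo S])
  show "inj_on f S" using bij by (simp add: bij_betw_def)
  fix g assume "g holomorphic_on f ` S" "\<And>z. z \<in> S \<Longrightarrow> g (f z) = z"
  then show thesis using that[of g] bij by (simp add: bij_betw_def)
qed

text \<open>\<open>Re q\<close> is a harmonic majorant that is large where \<open>\<phi> z\<close>
  is far from \<open>p\<close> on the scale of \<open>dist (\<phi> w) p\<close>, yet has a universal
  value at \<open>w\<close>. It is the logarithm of the modulus of \<open>7 * (s + 1)\<close>, with
  \<open>s\<close> a square root of the normalised map \<open>F\<close>; the root exists because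
  \<open>\<phi>\<close> omits \<open>p\<close>.\<close>

lemma barrier:
  fixes \<phi> :: "complex \<Rightarrow> complex"
  assumes holo: "\<phi> holomorphic_on ball 0 1" and bij: "bij_betw \<phi> (ball 0 1) V"
    and w: "cmod w < 1" and p: "p \<notin> V" and ball: "ball (\<phi> w) (dist (\<phi> w) p) \<subseteq> V"
  obtains q where "q holomorphic_on ball 0 1" "q \<in> borel_measurable borel" "Re (q w) = ln 14"
    "\<And>z. cmod z < 1 \<Longrightarrow> ln (1 + sqrt (dist (\<phi> z) p / dist (\<phi> w) p)) \<le> Re (q z)"
proof -
  define F where "F z = (\<phi> z - p) / (\<phi> w - p)" for z
  have inV: "\<phi> z \<in> V" if "cmod z < 1" for z
    using bij that by (auto simp: bij_betw_def)
  have nz: "\<phi> z - p \<noteq> 0" if "cmod z < 1" for z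
    using inV[OF that] p by auto
  have hF: "F holomorphic_on ball 0 1"
    unfolding F_def by (intro holomorphic_intros holo) (use nz[OF w] in auto)
  have Fnz: "F z \<noteq> 0" if "z \<in> ball 0 1" for z
    using nz[OF w] nz[of z] that by (simp add: F_def)
  have Fw: "F w = 1"
    using nz[OF w] by (simp add: F_def)
  have Finj: "z = z'" if "F z = F z'" "cmod z < 1" "cmod z' < 1" for z z'
    using that nz[OF w] bij by (auto simp: F_def bij_betw_def inj_on_def)
  obtain s0 where hs0: "s0 holomorphic_on ball 0 1" and s0: "\<And>z. z \<in> ball 0 1 \<Longrightarrow> F z = (s0 z)\<^sup>2"
    using contractible_imp_holomorphic_sqrt[OF hF convex_imp_contractible[OF convex_ball] Fnz] by blast
  \<comment> \<open>\<open>s0 w\<close> is a square root of 1, so this factor selects the branch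
    with value 1 at \<open>w\<close>.\<close>
  define s where "s z = s0 z * s0 w" for z
  have s0w: "(s0 w)\<^sup>2 = 1" using s0[of w] w Fw by simp
  have hs: "s holomorphic_on ball 0 1"
    unfolding s_def by (intro holomorphic_intros hs0)
  have sF: "(s z)\<^sup>2 = F z" if "cmod z < 1" for z
    using s0[of z] s0w that by (simp add: s_def power_mult_distrib)
  have sw: "s w = 1" using s0w by (simp add: s_def power2_eq_square)
  text \<open>On the preimage of the disc about \<open>\<phi> w\<close> the root is the principal one; univalence of
    \<open>\<phi>\<close> then keeps \<open>s\<close> away from the reflected disc about \<open>-1\<close>.\<close>
  obtain \<psi> where hpsi: "\<psi> holomorphic_on V" and psi: "\<And>z. z \<in> ball 0 1 \<Longrightarrow> \<psi> (\<phi> z) = z"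
    using bij_holomorphic_inverse[OF holo open_ball bij] by auto
  define X where "X = \<psi> ` ball (\<phi> w) (dist (\<phi> w) p)"
  have X: "z \<in> X" if "cmod z < 1" "\<phi> z \<in> ball (\<phi> w) (dist (\<phi> w) p)" for z
    unfolding X_def by (rule image_eqI[of _ _ "\<phi> z"]) (use psi[of z] that in auto)
  have XF: "cmod z < 1 \<and> cmod (F z - 1) < 1" if "z \<in> X" for z
  proof -
    obtain y where y: "y \<in> ball (\<phi> w) (dist (\<phi> w) p)" "z = \<psi> y" using \<open>z \<in> X\<close> by (auto simp: X_def)
    have "y \<in> \<phi> ` ball 0 1" using y(1) ball bij unfolding bij_betw_def by blast
    then obtain z' where z': "cmod z' < 1" "y = \<phi> z'" by auto
    have z: "z = z'" using y z' psi[of z'] by simp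
    have "F z - 1 = (y - \<phi> w) / (\<phi> w - p)"
      using nz[OF w] by (simp add: F_def z z' field_simps)
    then show ?thesis using y z z' nz[OF w] by (simp add: norm_divide dist_norm norm_minus_commute)
  qed
  have "connected X"
    unfolding X_def
    by (rule connected_continuous_image[OF continuous_on_subset[OF holomorphic_on_imp_continuous_on[OF hpsi] ball]])
      simp
  have "continuous_on X (\<lambda>z. Re (s z))"
    using XF by (intro continuous_intros continuous_on_subset[OF holomorphic_on_imp_continuous_on[OF hs]]) auto
  then have conn: "connected ((\<lambda>z. Re (s z)) ` X)"
    using \<open>connected X\<close> by (rule connected_continuous_image)
  \<comment> \<open>An imaginary value of \<open>s\<close> would make \<open>F\<close> a nonpositive
    real, outside the unit disc about 1.\<close>
  have Re_nz: "Re (s z) \<noteq> 0" if "z \<in> X" for z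
  proof
    assume "Re (s z) = 0"
    then have "Re (F z) \<le> 0" using XF[OF that] unfolding sF[of z, symmetric, OF conjunct1[OF XF[OF that]]]
      by (simp add: power2_eq_square)
    moreover have "\<bar>Re (F z - 1)\<bar> < 1" using XF[OF that] abs_Re_le_cmod[of "F z - 1"] by linarith
    ultimately show False by simp
  qed
  have "w \<in> X" using X[OF w] nz[OF w] by auto
  have Re_pos: "0 < Re (s z)" if "z \<in> X" for z
  proof (rule ccontr)
    assume "\<not> 0 < Re (s z)"
    moreover have "Re (s w) \<in> (\<lambda>z. Re (s z)) ` X" "Re (s z) \<in> (\<lambda>z. Re (s z)) ` X"
      using that \<open>w \<in> X\<close> by blast+
    ultimately have "0 \<in> (\<lambda>z. Re (s z)) ` X"
      using connectedD_interval[OF conn, of "Re (s z)" "Re (s w)" 0] sw by simp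
    then show False using Re_nz by auto
  qed
  \<comment> \<open>If \<open>s z\<close> were within 1/3 of -1, then
    \<open>F - 1 = (s + 1) * (s - 1)\<close> would have modulus at most 7/9. So \<open>z\<close>
    would lie in \<open>X\<close>, where \<open>Re s\<close> is positive, which is impossible so
    near -1.\<close>
  have away: "1 / 3 \<le> cmod (s z + 1)" if z: "cmod z < 1" for z
  proof (rule ccontr)
    assume "\<not> 1 / 3 \<le> cmod (s z + 1)"
    then have c: "cmod (s z + 1) < 1 / 3" by simp
    have "cmod (s z - 1) \<le> 7 / 3"
      using norm_triangle_ineq4[of "s z + 1" 2] c by simp
    then have "cmod (s z + 1) * cmod (s z - 1) \<le> 1 / 3 * (7 / 3)"
      using c by (intro mult_mono) auto
    moreover have "F z - 1 = (s z + 1) * (s z - 1)"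
      unfolding sF[OF z, symmetric] by (simp add: power2_eq_square algebra_simps)
    ultimately have "cmod (F z - 1) < 1"
      by (simp add: norm_mult)
    moreover have "F z - 1 = (\<phi> z - \<phi> w) / (\<phi> w - p)"
      using nz[OF w] by (simp add: F_def field_simps)
    ultimately have "\<phi> z \<in> ball (\<phi> w) (dist (\<phi> w) p)"
      using nz[OF w] by (simp add: norm_divide dist_norm norm_minus_commute)
    then have "0 < Re (s z)" using X[OF z] Re_pos by blast
    moreover have "\<bar>Re (s z + 1)\<bar> < 1 / 3" using c abs_Re_le_cmod[of "s z + 1"] by linarith
    ultimately show False by simp
  qed
  text \<open>\<open>7 |s + 1|\<close> dominates \<open>1 + |s|\<close> because \<open>|s + 1| \<ge> 1 / 3\<close>, and \<open>14\<close> is its value at \<open>w\<close>.\<close>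
  have h7: "(\<lambda>z. 7 * (s z + 1)) holomorphic_on ball 0 1"
    by (intro holomorphic_intros hs)
  have nz7: "7 * (s z + 1) \<noteq> 0" if "z \<in> ball 0 1" for z
  proof -
    have "s z + 1 \<noteq> 0" using away[of z] that by force
    then show ?thesis by (simp del: distrib_left_numeral)
  qed
  obtain q where hq: "q holomorphic_on ball 0 1"
    and q: "\<And>z. z \<in> ball 0 1 \<Longrightarrow> 7 * (s z + 1) = exp (q z)"
    using contractible_imp_holomorphic_log[OF h7 convex_imp_contractible[OF convex_ball] nz7] by blast
  have Req: "Re (q z) = ln (7 * cmod (s z + 1))" if "cmod z < 1" for z
  proof -
    have "cmod (7 * (s z + 1)) = exp (Re (q z))" using q[of z] that by (simp only: norm_exp_eq_Re mem_ball_0)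
    then show ?thesis by (simp only: norm_mult norm_numeral ln_exp)
  qed
  show ?thesis
  proof (rule that[of "cut q"])
    show "cut q holomorphic_on ball 0 1" "cut q \<in> borel_measurable borel"
      using hq by (simp_all add: holomorphic_cut borel_cut)
    show "Re (cut q w) = ln 14" using Req[OF w] w sw by simp
    fix z :: complex assume z: "cmod z < 1"
    have "cmod (s z) = sqrt (cmod (F z))"
      by (metis abs_norm_cancel norm_power real_sqrt_abs sF z)
    also have "cmod (F z) = dist (\<phi> z) p / dist (\<phi> w) p"
      by (simp add: F_def norm_divide dist_norm)
    finally have "1 + sqrt (dist (\<phi> z) p / dist (\<phi> w) p) = 1 + cmod (s z)" by simp
    also have "\<dots> \<le> 7 * cmod (s z + 1)"
      using norm_triangle_ineq4[of "s z + 1" 1] away[OF z] by simp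
    finally show "ln (1 + sqrt (dist (\<phi> z) p / dist (\<phi> w) p)) \<le> Re (cut q z)"
      using z away[OF z] by (simp add: Req del: ln_mult_pos)
        (subst ln_le_cancel_iff, auto intro: add_pos_nonneg)
  qed
qed

lemma ball_infdist_frontier:
  fixes V :: "'a::euclidean_space set"
  assumes "x \<in> V"
  shows "ball x (infdist x (frontier V)) \<subseteq> V"
proof (rule ccontr)
  assume "\<not> ?thesis"
  then obtain y where y: "y \<in> ball x (infdist x (frontier V))" "y \<notin> V" by blast
  then have "x \<in> ball x (infdist x (frontier V))"
    using zero_le_dist[of x y] by (simp del: zero_le_dist)
  then have "ball x (infdist x (frontier V)) \<inter> frontier V \<noteq> {}"
    using connected_Int_frontier[of "ball x (infdist x (frontier V))" V] y assms by blast
  then obtain z where "z \<in> frontier V" "dist x z < infdist x (frontier V)" by auto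
  then show False using infdist_le[of z "frontier V" x] by simp
qed

lemma nearest_frontier_point:
  assumes "simply_connected_domain V" "x \<in> V"
  obtains p where "p \<in> frontier V" "p \<notin> V" "dist x p = infdist x (frontier V)"
    "ball x (dist x p) \<subseteq> V" "0 < dist x p"
proof -
  have V: "open V" "V \<noteq> {}" "V \<noteq> UNIV" using assms by (auto simp: simply_connected_domain_def)
  then have "frontier V \<noteq> {}" by (simp add: frontier_eq_empty)
  then obtain p where p: "p \<in> frontier V" "infdist x (frontier V) = dist x p"
    using infdist_attains_inf[of "frontier V" x] by auto
  then have "p \<notin> V" using V by (auto simp: frontier_def interior_open)
  then show ?thesis using that[of p] p ball_infdist_frontier[OF assms(2)] assms(2) by auto
qed

section \<open>Radial limits along a sequence of radii\<close>

definition rad :: "nat \<Rightarrow> real" where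
  "rad n = 1 - 1 / real (Suc n)"

lemma rad: "0 \<le> rad n" "rad n < 1" "rad \<longlonglongrightarrow> 1"
proof -
  show "rad \<longlonglongrightarrow> 1"
    unfolding rad_def using tendsto_diff[OF tendsto_const LIMSEQ_inverse_real_of_nat, of 1]
    by (simp add: inverse_eq_divide)
qed (simp_all add: rad_def)

lemma filterlim_rad: "filterlim rad (at_left 1) sequentially"
  using rad by (simp add: filterlim_at less_imp_neq)

text \<open>The limit is taken along a sequence so that it is Borel in \<open>\<xi>\<close>; the value is arbitrary where
  there is no radial limit.\<close>

definition rlim :: "(complex \<Rightarrow> complex) \<Rightarrow> complex \<Rightarrow> complex" where
  "rlim \<phi> \<xi> = lim (\<lambda>n. cut \<phi> (of_real (rad n) * \<xi>))"

lemma rlim_tendsto: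
  assumes "has_radial_limit \<phi> \<xi> p" "cmod \<xi> = 1"
  shows "(\<lambda>n. \<phi> (of_real (rad n) * \<xi>)) \<longlonglongrightarrow> p"
  using filterlim_compose[OF assms(1)[unfolded has_radial_limit_def] filterlim_rad] .

lemma rlim_eq:
  assumes "has_radial_limit \<phi> \<xi> p" "cmod \<xi> = 1"
  shows "rlim \<phi> \<xi> = p"
proof -
  have "cut \<phi> (of_real (rad n) * \<xi>) = \<phi> (of_real (rad n) * \<xi>)" for n
    using assms(2) rad(1,2)[of n] by (simp add: norm_mult)
  then show ?thesis unfolding rlim_def using limI[OF rlim_tendsto[OF assms]] by simp
qed

lemma borel_rlim: "rlim \<phi> \<in> borel_measurable borel" if "\<phi> holomorphic_on ball 0 1"
  unfolding rlim_def using borel_cut[OF that] by measurable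

text \<open>Fatou's lemma carries the barrier to the boundary: on the circle of radius
  \<open>rad n\<close> the Poisson mean of \<open>Re q\<close> is its value at
  \<open>rad n * w\<close>, which tends to \<open>ln 14\<close>. Extended nonnegative integrals make
  integrability of the boundary function a consequence.\<close>

lemma barrier_mean:
  assumes phi: "riemann_map V \<phi>"
    and lim: "AE \<xi> in circ. \<exists>p. has_radial_limit \<phi> \<xi> p"
    and w: "cmod w < 1" and p: "p \<notin> V" "ball (\<phi> w) (dist (\<phi> w) p) \<subseteq> V"
  shows "(\<integral>\<^sup>+\<xi>. ennreal (poisson w \<xi> * ln (1 + sqrt (dist (rlim \<phi> \<xi>) p / dist (\<phi> w) p))) \<partial>circ) \<le> ennreal (ln 14)"
proof -
  have holo: "\<phi> holomorphic_on ball 0 1" and bij: "bij_betw \<phi> (ball 0 1) V"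
    using phi by (auto simp: riemann_map_def)
  note [measurable] = borel_rlim[OF holo] borel_cut[OF holo]
  define d where "d = dist (\<phi> w) p"
  have d: "0 < d" using p w bij by (auto simp: d_def bij_betw_def)
  obtain q where q: "q holomorphic_on ball 0 1" and [measurable]: "q \<in> borel_measurable borel"
    and qw: "Re (q w) = ln 14"
    and le: "\<And>z. cmod z < 1 \<Longrightarrow> ln (1 + sqrt (dist (\<phi> z) p / d)) \<le> Re (q z)"
    using barrier[OF holo bij w p] unfolding d_def by blast
  define h where "h n \<xi> = ennreal (poisson w \<xi> * ln (1 + sqrt (dist (cut \<phi> (of_real (rad n) * \<xi>)) p / d)))" for n \<xi>
  have [measurable]: "h n \<in> borel_measurable circ" for n unfolding h_def by measurable
  have "(\<integral>\<^sup>+\<xi>. ennreal (poisson w \<xi> * ln (1 + sqrt (dist (rlim \<phi> \<xi>) p / d))) \<partial>circ)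
      = (\<integral>\<^sup>+\<xi>. liminf (\<lambda>n. h n \<xi>) \<partial>circ)"
  proof (rule nn_integral_cong_AE, use lim AE_circ_norm in eventually_elim)
    case (elim \<xi>)
    then obtain u where u: "has_radial_limit \<phi> \<xi> u" by blast
    have "(\<lambda>n. cut \<phi> (of_real (rad n) * \<xi>)) \<longlonglongrightarrow> u"
      using rlim_tendsto[OF u elim(2)] elim(2) rad(1,2) by (simp add: norm_mult)
    then have "(\<lambda>n. h n \<xi>) \<longlonglongrightarrow> ennreal (poisson w \<xi> * ln (1 + sqrt (dist (rlim \<phi> \<xi>) p / d)))"
      unfolding h_def rlim_eq[OF u elim(2)] using d
      by (intro tendsto_intros) (auto simp: add_nonneg_eq_0_iff)
    from lim_imp_Liminf[OF _ this] show ?case by simp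
  qed
  also have "\<dots> \<le> liminf (\<lambda>n. integral\<^sup>N circ (h n))"
    by (rule nn_integral_liminf) measurable
  also have "\<dots> \<le> liminf (\<lambda>n. ennreal (Re (q (of_real (rad n) * w))))"
  proof (rule Liminf_mono, rule always_eventually, rule allI)
    fix n
    have "integral\<^sup>N circ (h n) \<le> (\<integral>\<^sup>+\<xi>. ennreal (poisson w \<xi> * Re (q (of_real (rad n) * \<xi>))) \<partial>circ)"
    proof (rule nn_integral_mono_AE, use AE_circ_norm in eventually_elim)
      case (elim \<xi>)
      then show ?case
        unfolding h_def using le[of "of_real (rad n) * \<xi>"] rad(1,2)[of n] poisson_nonneg[OF w]
        by (intro ennreal_leI mult_left_mono) (auto simp: norm_mult)
    qed
    also have "\<dots> = ennreal (\<integral>\<xi>. poisson w \<xi> * Re (q (of_real (rad n) * \<xi>)) \<partial>circ)"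
    proof (rule nn_integral_eq_integral)
      show "AE \<xi> in circ. 0 \<le> poisson w \<xi> * Re (q (of_real (rad n) * \<xi>))"
        using AE_circ_norm
      proof eventually_elim
        case (elim \<xi>)
        have "0 \<le> ln (1 + sqrt (dist (\<phi> (of_real (rad n) * \<xi>)) p / d))"
          using d by (intro ln_ge_zero) auto
        then show ?case
          using le[of "of_real (rad n) * \<xi>"] rad(1,2)[of n] elim poisson_nonneg[OF w, of \<xi>]
          by (intro mult_nonneg_nonneg) (auto simp: norm_mult)
      qed
    qed (rule poisson_mean_Re, use q w rad in auto)
    also have "\<dots> = ennreal (Re (q (of_real (rad n) * w)))"
      using poisson_mean_Re(2)[OF q _ w rad(1,2)] by simp
    finally show "integral\<^sup>N circ (h n) \<le> ennreal (Re (q (of_real (rad n) * w)))" .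
  qed
  also have "\<dots> = ennreal (ln 14)"
  proof (rule lim_imp_Liminf)
    have "isCont q w"
      using holomorphic_on_imp_continuous_on[OF q] w by (simp add: continuous_on_eq_continuous_at)
    then have "(\<lambda>n. q (of_real (rad n) * w)) \<longlonglongrightarrow> q w"
      by (rule isCont_tendsto_compose) (auto intro!: tendsto_eq_intros rad)
    then show "(\<lambda>n. ennreal (Re (q (of_real (rad n) * w)))) \<longlonglongrightarrow> ennreal (ln 14)"
      unfolding qw[symmetric] by (intro tendsto_intros)
  qed simp
  finally show ?thesis by (simp add: d_def)
qed

subsection \<open>Boundary laws of holomorphic maps\<close>

lemma integral_poisson_le:
  assumes w: "cmod w < 1" and [measurable]: "g \<in> borel_measurable borel"
    and bound: "AE \<xi> in circ. \<bar>g \<xi>\<bar> \<le> B"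
  shows "integrable circ (\<lambda>\<xi>. poisson w \<xi> * g \<xi>)"
    and "\<bar>\<integral>\<xi>. poisson w \<xi> * g \<xi> \<partial>circ\<bar> \<le> B"
proof -
  have le: "AE \<xi> in circ. \<bar>poisson w \<xi> * g \<xi>\<bar> \<le> poisson w \<xi> * B"
    using bound by eventually_elim (simp add: abs_mult poisson_nonneg[OF w] mult_left_mono)
  have iB: "integrable circ (\<lambda>\<xi>. poisson w \<xi> * B)"
    using poisson_total(1)[OF w] by simp
  show int: "integrable circ (\<lambda>\<xi>. poisson w \<xi> * g \<xi>)"
    by (rule Bochner_Integration.integrable_bound[OF iB]) (use le in \<open>auto elim!: eventually_mono\<close>)
  have "\<bar>\<integral>\<xi>. poisson w \<xi> * g \<xi> \<partial>circ\<bar> \<le> (\<integral>\<xi>. \<bar>poisson w \<xi> * g \<xi>\<bar> \<partial>circ)"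
    by (rule integral_abs_bound)
  also have "\<dots> \<le> (\<integral>\<xi>. poisson w \<xi> * B \<partial>circ)"
    by (rule integral_mono_AE) (use int iB le in auto)
  also have "\<dots> = B"
    using poisson_total(2)[OF w] by simp
  finally show "\<bar>\<integral>\<xi>. poisson w \<xi> * g \<xi> \<partial>circ\<bar> \<le> B" .
qed

text \<open>With \<open>d\<close> the distance of \<open>\<phi> w\<close> to the frontier, the part of the frontier at distance more than
  \<open>K d\<close> from the nearest frontier point has harmonic measure at most \<open>ln 14 / ln (1 + sqrt K)\<close>
  seen from \<open>\<phi> w\<close>, by Markov's inequality for the barrier.\<close>

lemma harmonic_extension_close:
  fixes T :: "complex \<Rightarrow> real"
  assumes V: "simply_connected_domain V" and phi: "riemann_map V \<phi>"
    and lim: "AE \<xi> in circ. \<exists>p. has_radial_limit \<phi> \<xi> p"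
    and w: "cmod w < 1" and K: "0 < K" and L: "0 \<le> L"
    and lip: "\<And>x y. \<bar>T x - T y\<bar> \<le> L * dist x y" and T01: "\<And>x. 0 \<le> T x" "\<And>x. T x \<le> 1"
    and [measurable]: "T \<in> borel_measurable borel"
  shows "\<bar>(\<integral>\<xi>. poisson w \<xi> * T (rlim \<phi> \<xi>) \<partial>circ) - T (\<phi> w)\<bar>
    \<le> L * (K + 1) * infdist (\<phi> w) (frontier V) + ln 14 / ln (1 + sqrt K)"
proof -
  have holo: "\<phi> holomorphic_on ball 0 1" and bij: "bij_betw \<phi> (ball 0 1) V"
    using phi by (auto simp: riemann_map_def)
  note [measurable] = borel_rlim[OF holo]
  have "\<phi> w \<in> V" using w bij by (auto simp: bij_betw_def)
  then obtain p where p: "p \<notin> V" "ball (\<phi> w) (dist (\<phi> w) p) \<subseteq> V"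
    and pd: "dist (\<phi> w) p = infdist (\<phi> w) (frontier V)" and pos: "0 < dist (\<phi> w) p"
    using nearest_frontier_point[OF V] by metis
  define d where "d = dist (\<phi> w) p"
  define h where "h \<xi> = ln (1 + sqrt (dist (rlim \<phi> \<xi>) p / d))" for \<xi>
  have [measurable]: "h \<in> borel_measurable borel" unfolding h_def by measurable
  have d: "0 < d" using pos by (simp add: d_def)
  have h0: "0 \<le> h \<xi>" for \<xi> unfolding h_def using d by (intro ln_ge_zero) auto
  have lnK: "0 < ln (1 + sqrt K)" using K by (intro ln_gt_zero) simp
  have nn: "(\<integral>\<^sup>+\<xi>. ennreal (poisson w \<xi> * h \<xi>) \<partial>circ) \<le> ennreal (ln 14)"
    using barrier_mean[OF phi lim w p] by (simp add: h_def d_def)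
  have ih: "integrable circ (\<lambda>\<xi>. poisson w \<xi> * h \<xi>)"
    by (rule integrableI_nonneg)
      (use nn h0 poisson_nonneg[OF w] in \<open>auto intro: le_less_trans\<close>)
  have hle: "(\<integral>\<xi>. poisson w \<xi> * h \<xi> \<partial>circ) \<le> ln 14"
    using nn by (subst (asm) nn_integral_eq_integral[OF ih])
      (auto simp: h0 poisson_nonneg[OF w])
  have iT: "integrable circ (\<lambda>\<xi>. poisson w \<xi> * T (rlim \<phi> \<xi>))"
    by (rule integral_poisson_le(1)[OF w, of _ 1]) (use T01 in auto)
  have iP: "integrable circ (poisson w)" by (rule poisson_total(1)[OF w])
  \<comment> \<open>Boundary points within \<open>K * d\<close> of \<open>p\<close> are within
    \<open>(K + 1) * d\<close> of \<open>\<phi> w\<close>, and the Lipschitz bound applies. At the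
    others \<open>T\<close> varies by at most 1, and the second summand is at least 1.\<close>
  have pt: "\<bar>T (rlim \<phi> \<xi>) - T (\<phi> w)\<bar> \<le> L * (K + 1) * d + h \<xi> / ln (1 + sqrt K)" for \<xi>
  proof (cases "dist (rlim \<phi> \<xi>) p \<le> K * d")
    case True
    have "dist (rlim \<phi> \<xi>) (\<phi> w) \<le> dist (rlim \<phi> \<xi>) p + d"
      unfolding d_def by (rule dist_triangle2)
    with True have "dist (rlim \<phi> \<xi>) (\<phi> w) \<le> (K + 1) * d" by (simp add: algebra_simps)
    then have "L * dist (rlim \<phi> \<xi>) (\<phi> w) \<le> L * (K + 1) * d"
      using mult_left_mono[OF _ L] by (simp add: mult.assoc)
    moreover have "0 \<le> h \<xi> / ln (1 + sqrt K)" using h0 lnK by simp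
    ultimately show ?thesis using lip[of "rlim \<phi> \<xi>" "\<phi> w"] by linarith
  next
    case False
    then have "K \<le> dist (rlim \<phi> \<xi>) p / d" using d by (simp add: field_simps)
    then have "ln (1 + sqrt K) \<le> h \<xi>"
      unfolding h_def using K by (subst ln_le_cancel_iff) (auto intro: add_pos_nonneg)
    then have "1 \<le> h \<xi> / ln (1 + sqrt K)" using lnK by simp
    moreover have "0 \<le> L * (K + 1) * d" using L K d by simp
    moreover have "\<bar>T (rlim \<phi> \<xi>) - T (\<phi> w)\<bar> \<le> 1"
      using T01[of "rlim \<phi> \<xi>"] T01[of "\<phi> w"] by linarith
    ultimately show ?thesis by linarith
  qed
  have "(\<integral>\<xi>. poisson w \<xi> * T (rlim \<phi> \<xi>) \<partial>circ) - T (\<phi> w)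
      = (\<integral>\<xi>. poisson w \<xi> * (T (rlim \<phi> \<xi>) - T (\<phi> w)) \<partial>circ)"
    using iT iP poisson_total(2)[OF w] by (simp add: right_diff_distrib)
  also have "\<bar>\<dots>\<bar> \<le> (\<integral>\<xi>. \<bar>poisson w \<xi> * (T (rlim \<phi> \<xi>) - T (\<phi> w))\<bar> \<partial>circ)"
    by (rule integral_abs_bound)
  also have "\<dots> \<le> (\<integral>\<xi>. poisson w \<xi> * (L * (K + 1) * d) + poisson w \<xi> * h \<xi> / ln (1 + sqrt K) \<partial>circ)"
  proof (rule integral_mono)
    show "integrable circ (\<lambda>\<xi>. \<bar>poisson w \<xi> * (T (rlim \<phi> \<xi>) - T (\<phi> w))\<bar>)"
      using iT iP by (simp add: right_diff_distrib)
    show "integrable circ (\<lambda>\<xi>. poisson w \<xi> * (L * (K + 1) * d) + poisson w \<xi> * h \<xi> / ln (1 + sqrt K))"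
      using iP ih by simp
    fix \<xi>
    show "\<bar>poisson w \<xi> * (T (rlim \<phi> \<xi>) - T (\<phi> w))\<bar>
        \<le> poisson w \<xi> * (L * (K + 1) * d) + poisson w \<xi> * h \<xi> / ln (1 + sqrt K)"
      using mult_left_mono[OF pt[of \<xi>] poisson_nonneg[OF w, of \<xi>]]
      by (simp add: abs_mult poisson_nonneg[OF w] distrib_left)
  qed
  also have "\<dots> = L * (K + 1) * d + (\<integral>\<xi>. poisson w \<xi> * h \<xi> \<partial>circ) / ln (1 + sqrt K)"
    using iP ih poisson_total(2)[OF w] by simp
  also have "\<dots> \<le> L * (K + 1) * d + ln 14 / ln (1 + sqrt K)"
    using hle lnK by (simp add: divide_right_mono)
  finally show ?thesis by (simp add: d_def pd)
qed

text \<open>First \<open>K\<close> is chosen to make the logarithmic term small, then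
  \<open>n\<close> to make the term with the distance to the frontier small. Convergence is assumed
  of the image points \<open>\<phi> (w n)\<close>, the form in which radial limits of another map
  into \<open>V\<close> provide it.\<close>

lemma harmonic_extension_tendsto:
  fixes T :: "complex \<Rightarrow> real"
  assumes V: "simply_connected_domain V" and phi: "riemann_map V \<phi>"
    and lim: "AE \<xi> in circ. \<exists>p. has_radial_limit \<phi> \<xi> p"
    and w: "\<And>n. cmod (w n) < 1" and conv: "(\<lambda>n. \<phi> (w n)) \<longlonglongrightarrow> p" and p: "p \<in> frontier V"
    and L: "0 \<le> L"
    and lip: "\<And>x y. \<bar>T x - T y\<bar> \<le> L * dist x y" and T01: "\<And>x. 0 \<le> T x" "\<And>x. T x \<le> 1"
    and T: "continuous_on UNIV T"
  shows "(\<lambda>n. \<integral>\<xi>. poisson (w n) \<xi> * T (rlim \<phi> \<xi>) \<partial>circ) \<longlonglongrightarrow> T p"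
proof -
  have Tm: "T \<in> borel_measurable borel" using T by (rule borel_measurable_continuous_onI)
  have d0: "(\<lambda>n. infdist (\<phi> (w n)) (frontier V)) \<longlonglongrightarrow> 0"
    using tendsto_infdist[OF conv, of "frontier V"] p by simp
  have "(\<lambda>n. (\<integral>\<xi>. poisson (w n) \<xi> * T (rlim \<phi> \<xi>) \<partial>circ) - T (\<phi> (w n))) \<longlonglongrightarrow> 0"
  proof (rule LIMSEQ_I)
    fix e :: real assume e: "0 < e"
    have "((\<lambda>K. ln 14 / ln (1 + sqrt K)) \<longlongrightarrow> 0) at_top"
      by (intro tendsto_divide_0[OF tendsto_const] filterlim_at_top_imp_at_infinity
          filterlim_compose[OF ln_at_top] filterlim_tendsto_add_at_top[OF tendsto_const] sqrt_at_top)
    then have "eventually (\<lambda>K. ln 14 / ln (1 + sqrt K) < e / 2) at_top"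
      using e by (intro order_tendstoD) auto
    moreover have "eventually (\<lambda>K::real. 0 < K) at_top" by (rule eventually_gt_at_top)
    ultimately have "eventually (\<lambda>K. ln 14 / ln (1 + sqrt K) < e / 2 \<and> 0 < K) at_top"
      by eventually_elim simp
    then obtain K where K: "0 < K" "ln 14 / ln (1 + sqrt K) < e / 2"
      by (auto simp: eventually_at_top_linorder)
    have "(\<lambda>n. L * (K + 1) * infdist (\<phi> (w n)) (frontier V)) \<longlonglongrightarrow> 0"
      using tendsto_mult_right_zero[OF d0] .
    then have "eventually (\<lambda>n. L * (K + 1) * infdist (\<phi> (w n)) (frontier V) < e / 2) sequentially"
      using e by (intro order_tendstoD) auto
    then obtain N where N: "\<And>n. n \<ge> N \<Longrightarrow> L * (K + 1) * infdist (\<phi> (w n)) (frontier V) < e / 2"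
      by (auto simp: eventually_sequentially)
    show "\<exists>N. \<forall>n\<ge>N. norm ((\<integral>\<xi>. poisson (w n) \<xi> * T (rlim \<phi> \<xi>) \<partial>circ) - T (\<phi> (w n)) - 0) < e"
    proof (intro exI[of _ N] allI impI)
      fix n assume "n \<ge> N"
      then show "norm ((\<integral>\<xi>. poisson (w n) \<xi> * T (rlim \<phi> \<xi>) \<partial>circ) - T (\<phi> (w n)) - 0) < e"
        using harmonic_extension_close[OF V phi lim w K(1) L lip T01 Tm, of n] N[of n] K(2)
        unfolding real_norm_def diff_0_right by linarith
    qed
  qed
  moreover have "(\<lambda>n. T (\<phi> (w n))) \<longlonglongrightarrow> T p"
    using T conv by (intro continuous_on_tendsto_compose[OF T]) auto
  ultimately show ?thesis using tendsto_add by force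
qed

text \<open>One class containing both the Riemann maps of \<open>V\<close> and the composites of
  maps into \<open>V\<close> with Riemann maps of other domains, so that their boundary laws can be
  compared.\<close>

definition boundary_map :: "complex set \<Rightarrow> (complex \<Rightarrow> complex) \<Rightarrow> bool" where
  "boundary_map V G \<longleftrightarrow> G holomorphic_on ball 0 1 \<and> G ` ball 0 1 \<subseteq> V \<and>
     (AE \<xi> in circ. \<exists>p\<in>frontier V. has_radial_limit G \<xi> p)"

lemma riemann_map_factor:
  assumes phi: "riemann_map V \<phi>" and G: "G holomorphic_on ball 0 1" "G ` ball 0 1 \<subseteq> V"
  obtains k where "k holomorphic_on ball 0 1" "k \<in> borel_measurable borel"
    "\<And>z. cmod z < 1 \<Longrightarrow> cmod (k z) < 1" "\<And>z. cmod z < 1 \<Longrightarrow> \<phi> (k z) = G z"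
proof -
  have holo: "\<phi> holomorphic_on ball 0 1" and bij: "inj_on \<phi> (ball 0 1)" "\<phi> ` ball 0 1 = V"
    using phi by (auto simp: riemann_map_def bij_betw_def)
  obtain \<psi> where psi: "\<psi> holomorphic_on V" "\<And>z. z \<in> ball 0 1 \<Longrightarrow> \<psi> (\<phi> z) = z"
    using bij_holomorphic_inverse[OF holo open_ball, of V] bij by (auto simp: bij_betw_def)
  have h: "\<psi> \<circ> G holomorphic_on ball 0 1"
    by (rule holomorphic_on_compose_gen[OF G(1) psi(1) G(2)])
  have inv: "cmod (\<psi> v) < 1 \<and> \<phi> (\<psi> v) = v" if "v \<in> V" for v
    using that psi(2) unfolding bij(2)[symmetric] by auto
  show ?thesis
  proof (rule that[of "cut (\<psi> \<circ> G)"])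
    show "cut (\<psi> \<circ> G) holomorphic_on ball 0 1" "cut (\<psi> \<circ> G) \<in> borel_measurable borel"
      using h by (simp_all add: holomorphic_cut borel_cut)
    show "cmod (cut (\<psi> \<circ> G) z) < 1" "\<phi> (cut (\<psi> \<circ> G) z) = G z" if "cmod z < 1" for z
      using that inv[of "G z"] G(2) by (simp_all add: image_subset_iff)
  qed
qed

text \<open>A harmonic function composed with a holomorphic self-map is harmonic and has the mean
  value property. Fubini reduces this to the kernel itself, where \<open>poisson_eq_Re\<close> shows
  that \<open>z \<mapsto> poisson (k z) \<xi>\<close> is the real part of a holomorphic
  function.\<close>

lemma mean_harmonic_extension:
  fixes T :: "complex \<Rightarrow> real"
  assumes k: "k holomorphic_on ball 0 1" and [measurable]: "k \<in> borel_measurable borel"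
    and k1: "\<And>z. cmod z < 1 \<Longrightarrow> cmod (k z) < 1" and r: "0 \<le> r" "r < 1"
    and [measurable]: "T \<in> borel_measurable borel" and T01: "\<And>x. 0 \<le> T x" "\<And>x. T x \<le> 1"
  shows "(\<integral>\<eta>. (\<integral>\<xi>. poisson (k (of_real r * \<eta>)) \<xi> * T \<xi> \<partial>circ) \<partial>circ)
    = (\<integral>\<xi>. poisson (k 0) \<xi> * T \<xi> \<partial>circ)"
proof -
  interpret pair_sigma_finite circ circ ..
  have kr: "cmod (k (of_real r * \<eta>)) < 1" if "cmod \<eta> = 1" for \<eta>
    using that r by (intro k1) (simp add: norm_mult)
  have k0: "cmod (k 0) < 1" by (rule k1) simp
  have nonneg: "AE \<eta> in circ. 0 \<le> (\<integral>\<xi>. poisson (k (of_real r * \<eta>)) \<xi> * T \<xi> \<partial>circ)"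
    using AE_circ_norm by eventually_elim (auto intro!: Bochner_Integration.integral_nonneg mult_nonneg_nonneg poisson_nonneg kr T01)
  have inner: "(\<integral>\<^sup>+\<eta>. ennreal (poisson (k (of_real r * \<eta>)) \<xi>) \<partial>circ) = ennreal (poisson (k 0) \<xi>)"
    if \<xi>: "cmod \<xi> = 1" for \<xi>
  proof -
    define q where "q z = (\<xi> + k z) / (\<xi> - k z)" for z
    have hq: "q holomorphic_on ball 0 1"
      unfolding q_def using k1 \<xi> by (intro holomorphic_intros k) force
    have [measurable]: "q \<in> borel_measurable borel" unfolding q_def by measurable
    have Req: "Re (q z) = poisson (k z) \<xi>" if "cmod z < 1" for z
      unfolding q_def using poisson_eq_Re[OF k1[OF that] \<xi>] by simp
    have "(\<integral>\<^sup>+\<eta>. ennreal (poisson (k (of_real r * \<eta>)) \<xi>) \<partial>circ)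
        = (\<integral>\<^sup>+\<eta>. ennreal (poisson 0 \<eta> * Re (q (of_real r * \<eta>))) \<partial>circ)"
    proof (rule nn_integral_cong_AE, use AE_circ_norm in eventually_elim)
      case (elim \<eta>) then show ?case using Req[of "of_real r * \<eta>"] r by (simp add: norm_mult)
    qed
    also have "\<dots> = ennreal (\<integral>\<eta>. poisson 0 \<eta> * Re (q (of_real r * \<eta>)) \<partial>circ)"
    proof (rule nn_integral_eq_integral)
      show "AE \<eta> in circ. 0 \<le> poisson 0 \<eta> * Re (q (of_real r * \<eta>))"
        using AE_circ_norm
      proof eventually_elim
        case (elim \<eta>) then show ?case
          using Req[of "of_real r * \<eta>"] r poisson_nonneg[OF kr[OF elim], of \<xi>] by (simp add: norm_mult)
      qed
    qed (rule poisson_mean_Re, use hq r in auto)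
    also have "\<dots> = ennreal (poisson (k 0) \<xi>)"
      using poisson_mean_Re(2)[OF hq _ _ r, of 0] Req[of 0] by simp
    finally show ?thesis .
  qed
  have "ennreal (\<integral>\<eta>. (\<integral>\<xi>. poisson (k (of_real r * \<eta>)) \<xi> * T \<xi> \<partial>circ) \<partial>circ)
      = (\<integral>\<^sup>+\<eta>. ennreal (\<integral>\<xi>. poisson (k (of_real r * \<eta>)) \<xi> * T \<xi> \<partial>circ) \<partial>circ)"
  proof (rule nn_integral_eq_integral[symmetric, OF _ nonneg], rule circ.integrable_const_bound[where B = 1])
    show "AE \<eta> in circ. norm (\<integral>\<xi>. poisson (k (of_real r * \<eta>)) \<xi> * T \<xi> \<partial>circ) \<le> 1"
      using AE_circ_norm
    proof eventually_elim
      case (elim \<eta>)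
      then show ?case using integral_poisson_le(2)[OF kr, of \<eta> T 1] T01 by simp
    qed
  qed measurable
  also have "\<dots> = (\<integral>\<^sup>+\<eta>. (\<integral>\<^sup>+\<xi>. ennreal (poisson (k (of_real r * \<eta>)) \<xi>) * ennreal (T \<xi>) \<partial>circ) \<partial>circ)"
  proof (rule nn_integral_cong_AE, use AE_circ_norm in eventually_elim)
    case (elim \<eta>)
    have "ennreal (\<integral>\<xi>. poisson (k (of_real r * \<eta>)) \<xi> * T \<xi> \<partial>circ)
        = (\<integral>\<^sup>+\<xi>. ennreal (poisson (k (of_real r * \<eta>)) \<xi> * T \<xi>) \<partial>circ)"
      using poisson_nonneg[OF kr[OF elim]] T01 kr[OF elim]
      by (intro nn_integral_eq_integral[symmetric] integral_poisson_le(1)[where B = 1]) auto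
    then show ?case using poisson_nonneg[OF kr[OF elim]] T01 by (simp add: ennreal_mult)
  qed
  also have "\<dots> = (\<integral>\<^sup>+\<xi>. (\<integral>\<^sup>+\<eta>. ennreal (poisson (k (of_real r * \<eta>)) \<xi>) * ennreal (T \<xi>) \<partial>circ) \<partial>circ)"
    by (rule Fubini') measurable
  also have "\<dots> = (\<integral>\<^sup>+\<xi>. ennreal (poisson (k 0) \<xi> * T \<xi>) \<partial>circ)"
  proof (rule nn_integral_cong_AE, use AE_circ_norm in eventually_elim)
    case (elim \<xi>)
    then show ?case
      using poisson_nonneg[OF k0] T01 by (simp add: nn_integral_multc inner ennreal_mult)
  qed
  also have "\<dots> = ennreal (\<integral>\<xi>. poisson (k 0) \<xi> * T \<xi> \<partial>circ)"
    using poisson_nonneg[OF k0] T01 k0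
    by (intro nn_integral_eq_integral integral_poisson_le(1)[where B = 1]) auto
  finally show ?thesis
    using integral_nonneg_AE[OF nonneg] poisson_nonneg[OF k0] T01
    by (subst (asm) ennreal_inj) (auto intro!: Bochner_Integration.integral_nonneg)
qed

text \<open>With \<open>G\<close> factored as \<open>\<phi>\<close> after \<open>k\<close>, the
  circular means of \<open>u\<close> after \<open>k\<close> all equal \<open>u \<alpha>\<close>.
  Along almost every radius the integrand tends to \<open>T\<close> at the radial limit of
  \<open>G\<close>, and dominated convergence passes to the limit.\<close>

lemma boundary_law_lipschitz:
  fixes T :: "complex \<Rightarrow> real"
  assumes V: "simply_connected_domain V" and phi: "riemann_map V \<phi>"
    and bphi: "boundary_map V \<phi>" and bG: "boundary_map V G"
    and \<alpha>: "cmod \<alpha> < 1" "\<phi> \<alpha> = G 0"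
    and L: "0 \<le> L"
    and lip: "\<And>x y. \<bar>T x - T y\<bar> \<le> L * dist x y" and T01: "\<And>x. 0 \<le> T x" "\<And>x. T x \<le> 1"
    and T: "continuous_on UNIV T"
  shows "(\<integral>\<xi>. T (rlim G \<xi>) \<partial>circ) = (\<integral>\<xi>. poisson \<alpha> \<xi> * T (rlim \<phi> \<xi>) \<partial>circ)"
proof -
  have holo: "\<phi> holomorphic_on ball 0 1" and hG: "G holomorphic_on ball 0 1" "G ` ball 0 1 \<subseteq> V"
    using bphi bG by (auto simp: boundary_map_def)
  have [measurable]: "T \<in> borel_measurable borel" using T by (rule borel_measurable_continuous_onI)
  note [measurable] = borel_rlim[OF holo] borel_rlim[OF hG(1)]
  have lim: "AE \<xi> in circ. \<exists>p. has_radial_limit \<phi> \<xi> p"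
    using bphi by (auto simp: boundary_map_def elim: eventually_mono)
  obtain k where k: "k holomorphic_on ball 0 1" and [measurable]: "k \<in> borel_measurable borel"
    and k1: "\<And>z. cmod z < 1 \<Longrightarrow> cmod (k z) < 1" and kG: "\<And>z. cmod z < 1 \<Longrightarrow> \<phi> (k z) = G z"
    using riemann_map_factor[OF phi hG] by blast
  have k0: "k 0 = \<alpha>"
    using phi k1[of 0] kG[of 0] \<alpha> by (auto simp: riemann_map_def bij_betw_def inj_on_def)
  define u where "u w = (\<integral>\<xi>. poisson w \<xi> * T (rlim \<phi> \<xi>) \<partial>circ)" for w
  have mean: "(\<integral>\<eta>. u (k (of_real (rad n) * \<eta>)) \<partial>circ) = u \<alpha>" for n
    unfolding u_def using mean_harmonic_extension[OF k _ k1 rad(1,2), where T = "\<lambda>\<xi>. T (rlim \<phi> \<xi>)"] T01 k0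
    by simp
  have "(\<lambda>n. \<integral>\<eta>. u (k (of_real (rad n) * \<eta>)) \<partial>circ) \<longlonglongrightarrow> (\<integral>\<eta>. T (rlim G \<eta>) \<partial>circ)"
  proof (rule integral_dominated_convergence[where w = "\<lambda>_. 1"])
    show "AE \<eta> in circ. (\<lambda>n. u (k (of_real (rad n) * \<eta>))) \<longlonglongrightarrow> T (rlim G \<eta>)"
      using bG[unfolded boundary_map_def, THEN conjunct2, THEN conjunct2] AE_circ_norm
    proof eventually_elim
      case (elim \<eta>)
      then obtain p where p: "p \<in> frontier V" "has_radial_limit G \<eta> p" by blast
      have r1: "cmod (of_real (rad n) * \<eta>) < 1" for n using elim(2) rad(1,2)[of n] by (simp add: norm_mult)
      have "(\<lambda>n. \<phi> (k (of_real (rad n) * \<eta>))) \<longlonglongrightarrow> p"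
        using rlim_tendsto[OF p(2) elim(2)] kG[OF r1] by simp
      then show ?case
        unfolding u_def rlim_eq[OF p(2) elim(2)]
        by (intro harmonic_extension_tendsto[OF V phi lim k1[OF r1] _ p(1) L lip T01 T])
    qed
    fix n
    show "AE \<eta> in circ. norm (u (k (of_real (rad n) * \<eta>))) \<le> 1"
      using AE_circ_norm
    proof eventually_elim
      case (elim \<eta>)
      have "cmod (of_real (rad n) * \<eta>) < 1" using elim rad(1,2)[of n] by (simp add: norm_mult)
      from integral_poisson_le(2)[OF k1[OF this], of "\<lambda>\<xi>. T (rlim \<phi> \<xi>)" 1] T01
      show ?case by (simp add: u_def)
    qed
  qed (auto simp: u_def)
  then have "(\<integral>\<eta>. T (rlim G \<eta>) \<partial>circ) = u \<alpha>"
    unfolding mean by (simp add: LIMSEQ_const_iff)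
  then show ?thesis by (simp add: u_def)
qed

text \<open>Truncated distance functions are Lipschitz and decrease to the indicator of a closed
  set; closed sets form an intersection-stable generator of the Borel sets.\<close>

lemma measure_eqI_lipschitz:
  fixes M N :: "'a::metric_space measure"
  assumes "finite_measure M" "finite_measure N" and sets: "sets M = sets borel" "sets N = sets borel"
    and eq: "\<And>T L. 0 \<le> L \<Longrightarrow> (\<And>x y. \<bar>T x - T y\<bar> \<le> L * dist x y) \<Longrightarrow> (\<And>x. 0 \<le> T x) \<Longrightarrow>
      (\<And>x. T x \<le> 1) \<Longrightarrow> continuous_on UNIV T \<Longrightarrow> (\<integral>x. T x \<partial>M) = (\<integral>x. T x \<partial>N :: real)"
  shows "M = N"
proof -
  interpret M: finite_measure M by fact
  interpret N: finite_measure N by fact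
  note [measurable_cong] = sets
  have eq_closed: "measure M C = measure N C" if C: "closed C" for C
  proof -
    have [measurable]: "C \<in> sets borel" using C by (rule borel_closed)
    \<comment> \<open>The distance to the empty set is 0 by convention, so without the case
      distinction \<open>T n\<close> would be constantly 1 for empty \<open>C\<close>.\<close>
    define T where "T n x = (if C = {} then 0 else max 0 (1 - real n * infdist x C))" for n x
    have cT: "continuous_on UNIV (T n)" for n unfolding T_def by (cases "C = {}") (auto intro!: continuous_intros)
    have [measurable]: "T n \<in> borel_measurable borel" for n
      using cT by (rule borel_measurable_continuous_onI)
    have Tb: "0 \<le> T n x" "T n x \<le> 1" for n x
      by (auto simp: T_def infdist_nonneg)
    have lip: "\<bar>T n x - T n y\<bar> \<le> real n * dist x y" for n x y
    proof -
      have "\<bar>max 0 (1 - a) - max 0 (1 - b)\<bar> \<le> \<bar>a - b\<bar>" for a b :: real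
        by (auto simp: max_def abs_if)
      then have "\<bar>T n x - T n y\<bar> \<le> \<bar>real n * (infdist x C - infdist y C)\<bar>"
        unfolding T_def by (simp add: right_diff_distrib)
      also have "\<dots> \<le> real n * dist x y"
        using infdist_triangle_abs[of x C y] by (simp add: abs_mult mult_left_mono)
      finally show ?thesis .
    qed
    have Tlim: "(\<lambda>n. T n x) \<longlonglongrightarrow> indicator C x" for x
    proof (cases "x \<in> C \<or> C = {}")
      case True then show ?thesis by (cases "C = {}") (auto simp: T_def)
    next
      case False
      then have pos: "0 < infdist x C" using C by (simp add: infdist_pos_not_in_closed)
      obtain N where N: "1 < real N * infdist x C" using reals_Archimedean3[OF pos] by blast
      have "eventually (\<lambda>n. T n x = 0) sequentially"
        using eventually_ge_at_top[of N]
      proof eventually_elim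
        case (elim n)
        have "real N * infdist x C \<le> real n * infdist x C" using elim pos by (intro mult_right_mono) auto
        then show ?case using N by (simp add: T_def)
      qed
      then show ?thesis using False by (simp add: tendsto_eventually)
    qed
    have l1: "(\<lambda>n. \<integral>x. T n x \<partial>M) \<longlonglongrightarrow> (\<integral>x. indicator C x \<partial>M)"
      by (rule integral_dominated_convergence[where w = "\<lambda>_. 1"]) (use Tlim Tb in auto)
    have l2: "(\<lambda>n. \<integral>x. T n x \<partial>N) \<longlonglongrightarrow> (\<integral>x. indicator C x \<partial>N)"
      by (rule integral_dominated_convergence[where w = "\<lambda>_. 1"]) (use Tlim Tb in auto)
    have l3: "(\<integral>x. T n x \<partial>M) = (\<integral>x. T n x \<partial>N)" for n
      by (rule eq[OF _ lip Tb cT]) simp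
    have "(\<integral>x. indicator C x \<partial>M) = (\<integral>x. indicat_real C x \<partial>N)"
      by (rule LIMSEQ_unique[OF l1[unfolded l3] l2])
    then show ?thesis by simp
  qed
  show ?thesis
  proof (rule measure_eqI_generator_eq[where E = "Collect closed" and \<Omega> = UNIV and A = "\<lambda>_. UNIV"])
    show "Int_stable (Collect closed :: 'a set set)" by (auto simp: Int_stable_def)
    show "emeasure M C = emeasure N C" if "C \<in> Collect closed" for C
      using eq_closed[of C] that by (simp add: M.emeasure_eq_measure N.emeasure_eq_measure)
    show "sets M = sigma_sets UNIV (Collect closed)" "sets N = sigma_sets UNIV (Collect closed)"
      by (simp_all add: sets borel_eq_closed)
  qed auto
qed

text \<open>Both sides are the harmonic measure of \<open>V\<close> seen from \<open>G 0\<close>.\<close>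

lemma boundary_law:
  assumes V: "simply_connected_domain V" and phi: "riemann_map V \<phi>"
    and bphi: "boundary_map V \<phi>" and bG: "boundary_map V G"
    and \<alpha>: "cmod \<alpha> < 1" "\<phi> \<alpha> = G 0"
  shows "distr circ borel (rlim G) = distr (density circ (poisson \<alpha>)) borel (rlim \<phi>)"
proof (rule measure_eqI_lipschitz)
  have holo: "\<phi> holomorphic_on ball 0 1" and hG: "G holomorphic_on ball 0 1"
    using bphi bG by (auto simp: boundary_map_def)
  note [measurable] = borel_rlim[OF holo] borel_rlim[OF hG]
  let ?M = "distr circ borel (rlim G)" and ?N = "distr (density circ (poisson \<alpha>)) borel (rlim \<phi>)"
  show "finite_measure ?M"
    by (intro prob_space.finite_measure circ.prob_space_distr) measurable
  show "finite_measure ?N"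
    by (intro prob_space.finite_measure prob_space.prob_space_distr prob_spaceI)
      (auto simp: emeasure_density poisson_total(3)[OF \<alpha>(1)])
  fix T :: "complex \<Rightarrow> real" and L :: real
  assume T: "0 \<le> L" "\<And>x y. \<bar>T x - T y\<bar> \<le> L * dist x y" "\<And>x. 0 \<le> T x" "\<And>x. T x \<le> 1" "continuous_on UNIV T"
  have [measurable]: "T \<in> borel_measurable borel" using T(5) by (rule borel_measurable_continuous_onI)
  have "(\<integral>x. T x \<partial>?M) = (\<integral>\<xi>. T (rlim G \<xi>) \<partial>circ)"
    by (rule integral_distr) measurable
  also have "\<dots> = (\<integral>\<xi>. poisson \<alpha> \<xi> * T (rlim \<phi> \<xi>) \<partial>circ)"
    by (rule boundary_law_lipschitz[OF V phi bphi bG \<alpha> T])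
  also have "\<dots> = (\<integral>\<xi>. T (rlim \<phi> \<xi>) \<partial>density circ (poisson \<alpha>))"
    by (subst integral_real_density) (auto simp: poisson_nonneg[OF \<alpha>(1)])
  also have "\<dots> = (\<integral>x. T x \<partial>?N)"
    by (rule integral_distr[symmetric]) measurable
  finally show "(\<integral>x. T x \<partial>?M) = (\<integral>x. T x \<partial>?N)" .
qed simp_all

lemma measure_circ_UNIV [simp]: "measure circ UNIV = 1" "emeasure circ UNIV = 1"
  using circ.prob_space circ.emeasure_space_1 by simp_all

subsection \<open>Completed harmonic measure\<close>

text \<open>Lusin's theorem in disguise: inner regularity is applied to the image measure on the graph.\<close>

lemma completion_image_contains_borel:
  fixes M :: "'a::polish_space measure" and X :: "'a \<Rightarrow> 'b::polish_space"
  assumes fin: "finite_measure M" and sM: "sets M = sets borel" and X: "X \<in> borel_measurable borel"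
    and E: "E \<in> sets (completion M)"
  obtains B where "B \<in> sets borel" "B \<subseteq> X ` E" "AE x in M. x \<in> E \<longrightarrow> X x \<in> B"
proof -
  interpret finite_measure M by fact
  note [measurable] = X and [measurable_cong] = sM
  \<comment> \<open>A Borel subset of \<open>E\<close> with the same completed measure.\<close>
  define E' where "E' = main_part M E"
  have E'M: "E' \<in> sets M" "E' \<subseteq> E" using E main_part_null_part_Un[OF E] unfolding E'_def by (blast intro: main_part_sets)+
  then have E'[measurable]: "E' \<in> sets borel" by (simp add: sM)
  have ae: "AE x in M. x \<in> E \<longrightarrow> x \<in> E'"
    using AE_in_main_part[OF E] unfolding E'_def by eventually_elim auto
  define N where "N = distr (density M (indicator E')) borel (\<lambda>x. (x, X x))"
  have XX[measurable]: "(\<lambda>x. (x, X x)) \<in> borel_measurable borel" by measurable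
  have sN: "sets N = sets borel" by (simp add: N_def)
  have eN: "emeasure N S = emeasure M {x \<in> E'. (x, X x) \<in> S}" if [measurable]: "S \<in> sets borel" for S
  proof -
    have "emeasure N S = (\<integral>\<^sup>+x. indicator E' x * indicator ((\<lambda>x. (x, X x)) -` S) x \<partial>M)"
      unfolding N_def using measurable_sets[OF XX that]
      by (subst emeasure_distr) (auto simp: emeasure_density sM sets_eq_imp_space_eq[OF sM])
    also have "\<dots> = (\<integral>\<^sup>+x. indicator {x \<in> E'. (x, X x) \<in> S} x \<partial>M)"
      by (intro nn_integral_cong) (auto simp: indicator_def)
    also have "\<dots> = emeasure M {x \<in> E'. (x, X x) \<in> S}"
      by (rule nn_integral_indicator) (simp add: sM)
    finally show ?thesis .
  qed
  \<comment> \<open>The graph of \<open>X\<close> over \<open>E'\<close> is Borel and carries all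
    the mass of \<open>N\<close>, so compact subsets of it exhaust that mass.\<close>
  define \<Gamma> where "\<Gamma> = {p. fst p \<in> E' \<and> snd p = X (fst p)}"
  have \<Gamma>: "\<Gamma> \<in> sets borel"
  proof -
    have "{p \<in> space (borel \<Otimes>\<^sub>M borel). fst p \<in> E' \<and> snd p = X (fst p)} \<in> sets (borel \<Otimes>\<^sub>M borel)"
      by measurable
    then show ?thesis unfolding borel_prod by (simp add: \<Gamma>_def)
  qed
  have finN: "emeasure N (space N) \<noteq> \<infinity>"
    using eN[of UNIV] sets_eq_imp_space_eq[OF sN] by simp
  have sup: "emeasure N \<Gamma> = (SUP K \<in> {K. K \<subseteq> \<Gamma> \<and> compact K}. emeasure N K)"
    by (rule inner_regular[OF sN finN \<Gamma>])
  have "\<exists>K\<in>{K. K \<subseteq> \<Gamma> \<and> compact K}. emeasure N \<Gamma> < emeasure N K + ennreal (1 / Suc n)" for n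
    by (rule SUP_approx_ennreal[OF _ _ sup]) (use eN[OF \<Gamma>] in auto)
  then obtain K where K: "\<And>n. K n \<subseteq> \<Gamma>" "\<And>n. compact (K n)"
    and Kless: "\<And>n. emeasure N \<Gamma> < emeasure N (K n) + ennreal (1 / Suc n)"
    by (auto simp: Bex_def) metis
  have [measurable]: "K n \<in> sets borel" for n using K(2) by (intro borel_closed compact_imp_closed)
  define B where "B = (\<Union>n. snd ` K n)"
  have B[measurable]: "B \<in> sets borel"
    unfolding B_def using K(2)
    by (intro sets.countable_UN) (auto intro!: borel_closed compact_imp_closed compact_continuous_image continuous_intros)
  have sub: "B \<subseteq> X ` E"
    using K(1) E'M(2) unfolding B_def \<Gamma>_def by fastforce
  \<comment> \<open>Points of \<open>Z\<close> have their graph points outside every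
    \<open>K n\<close>, so the measure of \<open>Z\<close> is at most the mass that
    \<open>K n\<close> misses.\<close>
  define Z where "Z = {x \<in> E'. X x \<notin> B}"
  have Z[measurable]: "Z \<in> sets borel" unfolding Z_def by measurable
  have "emeasure M Z \<le> ennreal (1 / Suc n)" for n
  proof -
    let ?Kn = "{x \<in> E'. (x, X x) \<in> K n}"
    have Kn: "?Kn \<in> sets M" unfolding sM by measurable
    have "emeasure M Z + emeasure M ?Kn = emeasure M (Z \<union> ?Kn)"
      using Z Kn by (intro plus_emeasure) (force simp: Z_def B_def sM image_iff)+
    also have "\<dots> \<le> emeasure M E'"
      by (intro emeasure_mono) (auto simp: Z_def E'M)
    also have "\<dots> = emeasure N \<Gamma>"
      using eN[OF \<Gamma>] by (simp add: \<Gamma>_def)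
    also have "\<dots> \<le> emeasure N (K n) + ennreal (1 / Suc n)"
      using Kless[of n] by simp
    also have "emeasure N (K n) = emeasure M ?Kn" by (rule eN) simp
    finally have "emeasure M ?Kn + emeasure M Z \<le> emeasure M ?Kn + ennreal (1 / Suc n)"
      by (simp add: add.commute)
    then show ?thesis
      by (subst (asm) ennreal_add_left_cancel_le) auto
  qed
  then have "emeasure M Z \<le> 0"
  proof -
    have "(\<lambda>n. ennreal (1 / Suc n)) \<longlonglongrightarrow> ennreal 0"
      using LIMSEQ_inverse_real_of_nat by (intro tendsto_ennrealI) (simp add: inverse_eq_divide)
    then show ?thesis
      using LIMSEQ_le_const[of "\<lambda>n. ennreal (1 / Suc n)" 0 "emeasure M Z"] \<open>\<And>n. emeasure M Z \<le> ennreal (1 / Suc n)\<close> by simp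
  qed
  then have "AE x in M. x \<notin> Z"
    by (intro AE_not_in) (auto simp: null_sets_def sM)
  with ae have "AE x in M. x \<in> E \<longrightarrow> X x \<in> B"
    by eventually_elim (auto simp: Z_def)
  then show ?thesis using that[OF B sub] by blast
qed

text \<open>Inner approximation of both \<open>A\<close> and its complement converts measurability
  of a preimage into a Borel sandwich in the target. In that form it can be handed to any other map
  whose law is absolutely continuous with respect to the law of \<open>X\<close>.\<close>

lemma vimage_completion_sandwich:
  fixes M :: "'a::polish_space measure" and X :: "'a \<Rightarrow> 'b::polish_space"
  assumes fin: "finite_measure M" and sM: "sets M = sets borel" and X: "X \<in> borel_measurable borel"
    and E: "X -` A \<in> sets (completion M)"
  obtains B C where "B \<in> sets borel" "C \<in> sets borel" "B \<subseteq> A" "A \<subseteq> C" "AE x in M. X x \<in> C \<longrightarrow> X x \<in> B"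
proof -
  have sp: "space M = UNIV" using sets_eq_imp_space_eq[OF sM] by simp
  have "space (completion M) - X -` A \<in> sets (completion M)"
    using E by (rule sets.compl_sets)
  then have E': "X -` (- A) \<in> sets (completion M)" by (simp add: sp vimage_Diff Compl_eq_Diff_UNIV)
  obtain B where B: "B \<in> sets borel" "B \<subseteq> X ` (X -` A)" "AE x in M. x \<in> X -` A \<longrightarrow> X x \<in> B"
    using completion_image_contains_borel[OF fin sM X E] .
  obtain D where D: "D \<in> sets borel" "D \<subseteq> X ` (X -` (- A))" "AE x in M. x \<in> X -` (- A) \<longrightarrow> X x \<in> D"
    using completion_image_contains_borel[OF fin sM X E'] .
  show ?thesis
  proof (rule that[of B "- D"])
    show "AE x in M. X x \<in> - D \<longrightarrow> X x \<in> B"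
      using B(3) D(3) by eventually_elim auto
  qed (use B D in auto)
qed

section \<open>Harmonic measure through centred Riemann maps\<close>

text \<open>The Riemann mapping theorem followed by a change of centre; this shows that the choice
  in \<open>riemann_map_at\<close> is made from a nonempty set.\<close>

lemma riemann_map_at:
  assumes V: "simply_connected_domain V" and z: "z \<in> V"
  shows "riemann_map V (riemann_map_at V z)" "riemann_map_at V z 0 = z"
proof -
  have "open V" "simply_connected V" "V \<noteq> {}" "V \<noteq> UNIV" using V by (auto simp: simply_connected_domain_def)
  then obtain f g where g: "g holomorphic_on ball 0 1" and fg: "\<forall>x\<in>V. f x \<in> ball 0 1 \<and> g (f x) = x"
    and gf: "\<forall>x\<in>ball 0 1. g x \<in> V \<and> f (g x) = x"
    using simply_connected_eq_biholomorphic_to_disc[OF \<open>open V\<close>] by blast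
  have fz: "f z \<in> ball 0 1" using fg z by blast
  \<comment> \<open>\<open>h\<close> moves \<open>f z\<close> to 0 and \<open>k\<close> is its
    inverse, so \<open>g \<circ> k\<close> sends 0 to \<open>z\<close>.\<close>
  define h k where "h = Moebius_function 0 (f z)" and "k = Moebius_function 0 (- f z)"
  have hk: "h (f z) = 0" "h ` ball 0 1 \<subseteq> ball 0 1" "k holomorphic_on ball 0 1" "k ` ball 0 1 \<subseteq> ball 0 1"
    and hkinv: "\<And>x. x \<in> ball 0 1 \<Longrightarrow> h (k x) = x" "\<And>x. x \<in> ball 0 1 \<Longrightarrow> k (h x) = x"
    using fz Moebius_function_norm_lt_1 Moebius_function_compose
    by (auto simp: h_def k_def Moebius_function_eq_zero intro!: Moebius_function_holomorphic)
  have "riemann_map V (g \<circ> k)"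
    unfolding riemann_map_def
  proof
    show "g \<circ> k holomorphic_on ball 0 1" by (rule holomorphic_on_compose_gen[OF hk(3) g hk(4)])
    have "bij_betw k (ball 0 1) (ball 0 1)"
      by (rule bij_betw_byWitness[of _ h]) (use hk hkinv in auto)
    moreover have "bij_betw g (ball 0 1) V"
      by (rule bij_betw_byWitness[of _ f]) (use fg gf in auto)
    ultimately show "bij_betw (g \<circ> k) (ball 0 1) V" by (rule bij_betw_trans)
  qed
  moreover have "(g \<circ> k) 0 = z"
    using fg z hk(1) hkinv(2)[OF fz] by simp
  ultimately have "\<exists>\<phi>. riemann_map V \<phi> \<and> \<phi> 0 = z" by blast
  from someI_ex[OF this]
  show "riemann_map V (riemann_map_at V z)" "riemann_map_at V z 0 = z"
    unfolding riemann_map_at_def by auto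
qed

text \<open>Almost everywhere existence of radial limits is carried as a property of the domain. For
  the domains \<open>U n\<close> it is read off from the full measure of the points with
  frontier-valued extensions.\<close>

definition regular_domain :: "complex set \<Rightarrow> bool" where
  "regular_domain V \<longleftrightarrow> simply_connected_domain V \<and> (\<forall>z\<in>V. boundary_map V (riemann_map_at V z))"

abbreviation bdry :: "complex set \<Rightarrow> complex \<Rightarrow> complex \<Rightarrow> complex" where
  "bdry V z \<equiv> rlim (riemann_map_at V z)"

lemma AE_radial_preimage:
  assumes "AE \<xi> in circ. \<exists>p. has_radial_limit \<phi> \<xi> p"
  shows "AE \<xi> in circ. \<xi> \<in> radial_preimage \<phi> A \<longleftrightarrow> rlim \<phi> \<xi> \<in> A"
  using assms AE_circ_norm
  by eventually_elim (auto simp: radial_preimage_def dest: rlim_eq)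

text \<open>Completeness lets arbitrary sets be exchanged when they agree almost everywhere; the
  Denjoy--Wolff set is handled in this way.\<close>

lemma sets_measure_completion_cong_AE:
  assumes "AE x in M. x \<in> A \<longleftrightarrow> x \<in> B" "A \<subseteq> space M" "B \<subseteq> space M"
  shows "A \<in> sets (completion M) \<longleftrightarrow> B \<in> sets (completion M)"
    and "measure (completion M) A = measure (completion M) B"
proof -
  have ae: "AE x in completion M. x \<in> A \<longleftrightarrow> x \<in> B" using assms(1) by (rule AE_completion)
  then have ae': "AE x in completion M. x \<in> B \<longleftrightarrow> x \<in> A" by eventually_elim auto
  show iff: "A \<in> sets (completion M) \<longleftrightarrow> B \<in> sets (completion M)"
    using completion.in_sets_AE[OF ae] completion.in_sets_AE[OF ae'] assms(2,3)
    unfolding space_completion by blast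
  show "measure (completion M) A = measure (completion M) B"
  proof (cases "A \<in> sets (completion M)")
    case True then show ?thesis using iff ae by (intro measure_eq_AE) auto
  next
    case False then show ?thesis using iff by (simp add: measure_notin_sets)
  qed
qed

lemma regular_domainD:
  assumes "regular_domain V" "z \<in> V"
  shows "riemann_map V (riemann_map_at V z)" "riemann_map_at V z 0 = z"
    "boundary_map V (riemann_map_at V z)" "AE \<xi> in circ. \<exists>p. has_radial_limit (riemann_map_at V z) \<xi> p"
    "bdry V z \<in> borel_measurable borel"
proof -
  show "riemann_map V (riemann_map_at V z)" "riemann_map_at V z 0 = z"
    "boundary_map V (riemann_map_at V z)" "bdry V z \<in> borel_measurable borel"
    using assms riemann_map_at[of V z] by (auto simp: regular_domain_def boundary_map_def borel_rlim)
  then have "AE \<xi> in circ. \<exists>p\<in>frontier V. has_radial_limit (riemann_map_at V z) \<xi> p"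
    by (auto simp: boundary_map_def)
  then show "AE \<xi> in circ. \<exists>p. has_radial_limit (riemann_map_at V z) \<xi> p"
    by eventually_elim auto
qed

text \<open>The radial preimage, which ignores radii without a limit, is exchanged for the preimage
  under a total Borel map.\<close>

lemma
  assumes "regular_domain V" "z \<in> V"
  shows harmonic_measurable_iff: "harmonic_measurable z A V \<longleftrightarrow> bdry V z -` A \<in> sets (completion circ)"
    and harmonic_measure_eq: "harmonic_measure z A V = measure (completion circ) (bdry V z -` A)"
  using sets_measure_completion_cong_AE[of "radial_preimage (riemann_map_at V z) A" "bdry V z -` A" circ]
    AE_radial_preimage[OF regular_domainD(4)[OF assms], of A]
  by (auto simp: harmonic_measurable_def harmonic_measure_def circle_measure_eq)

text \<open>A Borel sandwich for \<open>A\<close> under the law of \<open>bdry V z\<close> remains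
  one under the law of \<open>rlim G\<close>, since the latter comes from a density on the circle.
  The set \<open>E\<close> is the preimage of the inner Borel set, hence the same for all
  \<open>G\<close> and \<open>\<alpha>\<close>.\<close>

lemma boundary_law_completion:
  assumes V: "regular_domain V" and z: "z \<in> V" and A: "harmonic_measurable z A V"
  obtains E where "E \<in> sets borel" "\<forall>G \<alpha>. boundary_map V G \<and> cmod \<alpha> < 1 \<and> riemann_map_at V z \<alpha> = G 0 \<longrightarrow>
    rlim G -` A \<in> sets (completion circ) \<and>
    measure (completion circ) (rlim G -` A) = (\<integral>\<xi>. poisson \<alpha> \<xi> * indicator E \<xi> \<partial>circ)"
proof -
  let ?X = "bdry V z"
  note R = regular_domainD[OF V z]
  note [measurable] = R(5)
  obtain B C where [measurable]: "B \<in> sets borel" "C \<in> sets borel" and BC: "B \<subseteq> A" "A \<subseteq> C"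
    and ae: "AE x in circ. ?X x \<in> C \<longrightarrow> ?X x \<in> B"
    using vimage_completion_sandwich[OF circ.finite_measure_axioms sets_circ R(5)
        A[unfolded harmonic_measurable_iff[OF V z]]] .
  have [measurable]: "?X -` B \<in> sets borel" using measurable_sets[OF R(5), of B] by simp
  show ?thesis
  proof (rule that[of "?X -` B"], goal_cases)
    case 1
    show ?case by measurable
  next
    case 2
    show ?case
    proof (intro allI impI, elim conjE)
      fix G \<alpha> assume G: "boundary_map V G" and \<alpha>: "cmod \<alpha> < 1" "riemann_map_at V z \<alpha> = G 0"
      have hG: "G holomorphic_on ball 0 1" using G by (auto simp: boundary_map_def)
      note [measurable] = borel_rlim[OF hG]
      have law: "distr circ borel (rlim G) = distr (density circ (poisson \<alpha>)) borel ?X"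
        using boundary_law[OF _ R(1) R(3) G \<alpha>] V by (auto simp: regular_domain_def)
      have "AE x in density circ (poisson \<alpha>). ?X x \<in> C \<longrightarrow> ?X x \<in> B"
        using ae by (subst AE_density) auto
      then have "AE y in distr (density circ (poisson \<alpha>)) borel ?X. y \<in> C \<longrightarrow> y \<in> B"
        by (subst AE_distr_iff) auto
      then have "AE x in circ. rlim G x \<in> C \<longrightarrow> rlim G x \<in> B"
        unfolding law[symmetric] by (subst (asm) AE_distr_iff) auto
      then have "AE x in circ. x \<in> rlim G -` B \<longleftrightarrow> x \<in> rlim G -` A"
        by eventually_elim (use BC in auto)
      note eq = sets_measure_completion_cong_AE[OF this]
      have m: "rlim G -` B \<in> sets borel" using measurable_sets[OF borel_rlim[OF hG], of B] by simp
      have "measure (completion circ) (rlim G -` B) = measure (distr circ borel (rlim G)) B"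
        using m by (simp add: measure_distr)
      also have "\<dots> = measure (distr (density circ (poisson \<alpha>)) borel ?X) B" by (simp add: law)
      also have "\<dots> = measure (density circ (poisson \<alpha>)) (?X -` B)" by (simp add: measure_distr)
      also have "\<dots> = (\<integral>\<xi>. indicator (?X -` B) \<xi> \<partial>density circ (poisson \<alpha>))" by simp
      also have "\<dots> = (\<integral>\<xi>. poisson \<alpha> \<xi> * indicator (?X -` B) \<xi> \<partial>circ)"
        by (subst integral_real_density) (auto simp: poisson_nonneg[OF \<alpha>(1)])
      finally show "rlim G -` A \<in> sets (completion circ) \<and>
        measure (completion circ) (rlim G -` A) = (\<integral>\<xi>. poisson \<alpha> \<xi> * indicator (?X -` B) \<xi> \<partial>circ)"
        using eq m by auto
    qed
  qed
qed

lemma in_domain_riemann_map: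
  assumes "riemann_map V \<phi>" "z \<in> V"
  obtains w where "cmod w < 1" "\<phi> w = z"
  using assms by (auto simp: riemann_map_def bij_betw_def)

text \<open>Taking \<open>G\<close> to be the Riemann map centred at
  \<open>riemann_map_at V z \<alpha>\<close> shows that harmonic measure, as a function of its pole,
  is the Poisson integral of a single indicator.\<close>

lemma harmonic_measure_poisson:
  assumes V: "regular_domain V" and z: "z \<in> V" and A: "harmonic_measurable z A V"
  obtains E where "E \<in> sets borel" "\<forall>\<alpha>. cmod \<alpha> < 1 \<longrightarrow> harmonic_measurable (riemann_map_at V z \<alpha>) A V \<and>
    harmonic_measure (riemann_map_at V z \<alpha>) A V = (\<integral>\<xi>. poisson \<alpha> \<xi> * indicator E \<xi> \<partial>circ)"
proof -
  obtain E where E: "E \<in> sets borel" "\<forall>G \<alpha>. boundary_map V G \<and> cmod \<alpha> < 1 \<and> riemann_map_at V z \<alpha> = G 0 \<longrightarrow>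
    rlim G -` A \<in> sets (completion circ) \<and>
    measure (completion circ) (rlim G -` A) = (\<integral>\<xi>. poisson \<alpha> \<xi> * indicator E \<xi> \<partial>circ)"
    using boundary_law_completion[OF assms] .
  show ?thesis
  proof (rule that[OF E(1)], intro allI impI)
    fix \<alpha> :: complex assume \<alpha>: "cmod \<alpha> < 1"
    have v: "riemann_map_at V z \<alpha> \<in> V"
      using regular_domainD(1)[OF V z] \<alpha> by (auto simp: riemann_map_def bij_betw_def)
    show "harmonic_measurable (riemann_map_at V z \<alpha>) A V \<and>
      harmonic_measure (riemann_map_at V z \<alpha>) A V = (\<integral>\<xi>. poisson \<alpha> \<xi> * indicator E \<xi> \<partial>circ)"
      unfolding harmonic_measurable_iff[OF V v] harmonic_measure_eq[OF V v]
      using E(2) regular_domainD(2,3)[OF V v] \<alpha> by simp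
  qed
qed

lemma harmonic_measure_bound:
  assumes V: "regular_domain V" and z: "z \<in> V" and A: "harmonic_measurable z A V" and w: "cmod w < 1"
  shows "\<bar>harmonic_measure (riemann_map_at V z w) A V - harmonic_measure z A V\<bar> \<le> 2 * cmod w / (1 - cmod w)"
proof -
  obtain E where [measurable]: "E \<in> sets borel" and "\<forall>\<alpha>. cmod \<alpha> < 1 \<longrightarrow>
    harmonic_measurable (riemann_map_at V z \<alpha>) A V \<and>
    harmonic_measure (riemann_map_at V z \<alpha>) A V = (\<integral>\<xi>. poisson \<alpha> \<xi> * indicator E \<xi> \<partial>circ)"
    using harmonic_measure_poisson[OF assms(1-3)] .
  then have E: "harmonic_measure (riemann_map_at V z \<alpha>) A V = (\<integral>\<xi>. poisson \<alpha> \<xi> * indicator E \<xi> \<partial>circ)"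
    if "cmod \<alpha> < 1" for \<alpha> using that by blast
  have i: "integrable circ (\<lambda>\<xi>. poisson a \<xi> * indicator E \<xi>)" if "cmod a < 1" for a
    by (rule integral_poisson_le(1)[OF that, of _ 1]) (auto simp: indicator_def)
  have "harmonic_measure (riemann_map_at V z w) A V - harmonic_measure z A V
      = (\<integral>\<xi>. poisson w \<xi> * indicator E \<xi> - poisson 0 \<xi> * indicator E \<xi> \<partial>circ)"
    using E[OF w] E[of 0] regular_domainD(2)[OF V z] i[OF w] i[of 0] by simp
  also have "\<bar>\<dots>\<bar> \<le> (\<integral>\<xi>. \<bar>poisson w \<xi> * indicator E \<xi> - poisson 0 \<xi> * indicator E \<xi>\<bar> \<partial>circ)"
    by (rule integral_abs_bound)
  also have "\<dots> \<le> (\<integral>\<xi>. 2 * cmod w / (1 - cmod w) \<partial>circ)"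
  proof (rule integral_mono_AE)
    show "AE \<xi> in circ. \<bar>poisson w \<xi> * indicator E \<xi> - poisson 0 \<xi> * indicator E \<xi>\<bar> \<le> 2 * cmod w / (1 - cmod w)"
      using AE_circ_norm by eventually_elim (use poisson_diff_1[OF w] w in \<open>auto simp: indicator_def\<close>)
  qed (use i[OF w] i[of 0] in auto)
  also have "\<dots> = 2 * cmod w / (1 - cmod w)" by simp
  finally show ?thesis .
qed

section \<open>Constant Poisson integrals of indicators\<close>

text \<open>Poisson averaging at a fixed radius is thus a self-adjoint operation on functions on the
  circle.\<close>

lemma poisson_swap:
  assumes "cmod \<xi> = 1" "cmod \<eta> = 1"
  shows "poisson (of_real r * \<xi>) \<eta> = poisson (of_real r * \<eta>) \<xi>"
proof -
  have "(cmod (\<eta> - of_real r * \<xi>))\<^sup>2 = (cmod (\<xi> - of_real r * \<eta>))\<^sup>2"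
  proof -
    have "(Re \<xi>)\<^sup>2 + (Im \<xi>)\<^sup>2 = 1" "(Re \<eta>)\<^sup>2 + (Im \<eta>)\<^sup>2 = 1"
      using assms by (metis cmod_power2 one_power2)+
    then show ?thesis unfolding cmod_power2 by simp algebra
  qed
  then show ?thesis using assms by (simp add: poisson_def norm_mult)
qed

lemma simply_connected_domain_ball: "simply_connected_domain (ball 0 1)"
proof -
  have "(2::complex) \<notin> ball 0 1" by simp
  then have "ball (0::complex) 1 \<noteq> UNIV" by blast
  then show ?thesis
    by (simp add: simply_connected_domain_def convex_imp_simply_connected)
qed

lemma has_radial_limit_ident: "has_radial_limit (\<lambda>z. z) \<xi> \<xi>"
proof -
  have "((\<lambda>r. of_real r * \<xi>) \<longlongrightarrow> of_real 1 * \<xi>) (at_left 1)"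
    by (intro tendsto_intros)
  then show ?thesis by (simp add: has_radial_limit_def)
qed

text \<open>Tested against a Lipschitz function \<open>T\<close>, the averaging can be moved from
  \<open>T\<close> to the indicator of \<open>E\<close>, where it gives \<open>c\<close>; as the
  radius tends to 1 the averages of \<open>T\<close> return to \<open>T\<close>. Hence the indicator
  and the constant \<open>c\<close> are densities of the same measure.\<close>

lemma constant_poisson_integral_zero_one:
  assumes E[measurable]: "E \<in> sets borel"
    and const: "\<And>\<alpha>. cmod \<alpha> < 1 \<Longrightarrow> (\<integral>\<xi>. poisson \<alpha> \<xi> * indicator E \<xi> \<partial>circ) = c"
  shows "c = 0 \<or> c = 1"
proof -
  interpret pair_sigma_finite circ circ ..
  have "c = (\<integral>\<xi>. poisson 0 \<xi> * indicator E \<xi> \<partial>circ)" using const[of 0] by simp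
  also have "\<dots> = (\<integral>\<xi>. indicator E \<xi> \<partial>circ)"
    by (rule integral_cong_AE) (use AE_circ_norm in \<open>auto elim!: eventually_mono\<close>)
  finally have c: "c = measure circ E" by simp
  have c0: "0 \<le> c" by (simp add: c)
  have "density circ (\<lambda>x. ennreal (indicator E x)) = density circ (\<lambda>_. ennreal c)"
  proof (rule measure_eqI_lipschitz)
    show "finite_measure (density circ (\<lambda>x. ennreal (indicator E x)))" "finite_measure (density circ (\<lambda>_. ennreal c))"
      by (auto intro!: finite_measureI simp: emeasure_density nn_integral_cmult ennreal_indicator)
    fix T :: "complex \<Rightarrow> real" and L :: real
    assume T: "0 \<le> L" "\<And>x y. \<bar>T x - T y\<bar> \<le> L * dist x y" "\<And>x. 0 \<le> T x" "\<And>x. T x \<le> 1" "continuous_on UNIV T"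
    have [measurable]: "T \<in> borel_measurable borel" using T(5) by (rule borel_measurable_continuous_onI)
    define v where "v w = (\<integral>\<eta>. poisson w \<eta> * T \<eta> \<partial>circ)" for w
    have [measurable]: "v \<in> borel_measurable borel" unfolding v_def by measurable
    have v01: "0 \<le> v w \<and> v w \<le> 1" if "cmod w < 1" for w
      using integral_poisson_le(2)[OF that, of T 1] T(3,4) poisson_nonneg[OF that]
      by (auto simp: v_def intro!: Bochner_Integration.integral_nonneg)
    have r1: "cmod (of_real (rad n) * \<xi>) < 1" if "cmod \<xi> = 1" for n \<xi>
      using that rad(1,2)[of n] by (simp add: norm_mult)
    have vlim: "(\<lambda>n. v (of_real (rad n) * \<xi>)) \<longlonglongrightarrow> T \<xi>" if \<xi>: "cmod \<xi> = 1" for \<xi>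
    proof -
      have "(\<lambda>n. of_real (rad n) * \<xi>) \<longlonglongrightarrow> of_real 1 * \<xi>"
        by (intro tendsto_intros rad)
      \<comment> \<open>The disc serves as the target domain, with the identity as its Riemann
        map.\<close>
      then have "(\<lambda>n. \<integral>\<eta>. poisson (of_real (rad n) * \<xi>) \<eta> * T (rlim (\<lambda>z. z) \<eta>) \<partial>circ) \<longlonglongrightarrow> T \<xi>"
        using \<xi> T r1[OF \<xi>]
        by (intro harmonic_extension_tendsto[OF simply_connected_domain_ball])
          (auto simp: riemann_map_def bij_betw_def intro!: holomorphic_intros has_radial_limit_ident)
      moreover have "(\<integral>\<eta>. poisson w \<eta> * T (rlim (\<lambda>z. z) \<eta>) \<partial>circ) = v w" for w
        unfolding v_def
      proof (rule integral_cong_AE)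
        show "AE \<eta> in circ. poisson w \<eta> * T (rlim (\<lambda>z. z) \<eta>) = poisson w \<eta> * T \<eta>"
          using AE_circ_norm by eventually_elim (simp add: rlim_eq[OF has_radial_limit_ident])
        have [measurable]: "rlim (\<lambda>z. z) \<in> borel_measurable borel"
          by (rule borel_rlim) (intro holomorphic_intros)
        show "(\<lambda>\<eta>. poisson w \<eta> * T (rlim (\<lambda>z. z) \<eta>)) \<in> borel_measurable circ" by measurable
      qed measurable
      ultimately show ?thesis by simp
    qed
    have "(\<lambda>n. \<integral>\<xi>. indicator E \<xi> * v (of_real (rad n) * \<xi>) \<partial>circ) \<longlonglongrightarrow> (\<integral>\<xi>. indicator E \<xi> * T \<xi> \<partial>circ)"
    proof (rule integral_dominated_convergence[where w = "\<lambda>_. 1"])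
      show "AE \<xi> in circ. (\<lambda>n. indicator E \<xi> * v (of_real (rad n) * \<xi>)) \<longlonglongrightarrow> indicator E \<xi> * T \<xi>"
        using AE_circ_norm by eventually_elim (intro tendsto_intros vlim)
      show "AE \<xi> in circ. norm (indicator E \<xi> * v (of_real (rad n) * \<xi>)) \<le> 1" for n
        using AE_circ_norm by eventually_elim (use v01[OF r1] in \<open>auto simp: indicator_def\<close>)
    qed auto
    moreover have "(\<integral>\<xi>. indicator E \<xi> * v (of_real (rad n) * \<xi>) \<partial>circ) = (\<integral>\<eta>. c * T \<eta> \<partial>circ)" for n
    proof -
      let ?r = "of_real (rad n) :: complex"
      have iT: "integrable circ T"
        by (rule circ.integrable_const_bound[where B = 1]) (use T(3,4) in auto)
      have iv: "integrable circ (\<lambda>\<xi>. indicator E \<xi> * v (?r * \<xi>))"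
        by (rule circ.integrable_const_bound[where B = 1])
          (use v01[OF r1] AE_circ_norm in \<open>auto simp: indicator_def elim!: eventually_mono\<close>)
      have pos: "AE \<xi> in circ. 0 \<le> indicator E \<xi> * v (?r * \<xi>)"
        using AE_circ_norm by eventually_elim (use v01[OF r1] in \<open>simp add: indicator_def\<close>)
      have nn1: "0 \<le> (\<integral>\<xi>. indicator E \<xi> * v (?r * \<xi>) \<partial>circ)"
        using pos by (rule integral_nonneg_AE)
      have nn2: "0 \<le> (\<integral>\<eta>. c * T \<eta> \<partial>circ)"
        using c0 T(3) by (intro Bochner_Integration.integral_nonneg) simp
      have "ennreal (\<integral>\<xi>. indicator E \<xi> * v (?r * \<xi>) \<partial>circ) = (\<integral>\<^sup>+\<xi>. ennreal (indicator E \<xi> * v (?r * \<xi>)) \<partial>circ)"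
        by (rule nn_integral_eq_integral[symmetric, OF iv pos])
      also have "\<dots> = (\<integral>\<^sup>+\<xi>. (\<integral>\<^sup>+\<eta>. ennreal (indicator E \<xi> * poisson (?r * \<xi>) \<eta> * T \<eta>) \<partial>circ) \<partial>circ)"
      proof (rule nn_integral_cong_AE, use AE_circ_norm in eventually_elim)
        case (elim \<xi>)
        have i: "integrable circ (\<lambda>\<eta>. poisson (?r * \<xi>) \<eta> * T \<eta>)"
          by (rule integral_poisson_le(1)[OF r1[OF elim], of _ 1]) (use T in auto)
        have "(\<integral>\<^sup>+\<eta>. ennreal (indicator E \<xi> * (poisson (?r * \<xi>) \<eta> * T \<eta>)) \<partial>circ)
            = ennreal (\<integral>\<eta>. indicator E \<xi> * (poisson (?r * \<xi>) \<eta> * T \<eta>) \<partial>circ)"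
          using i poisson_nonneg[OF r1[OF elim]] T(3)
          by (intro nn_integral_eq_integral) (auto simp: indicator_def)
        also have "(\<integral>\<eta>. indicator E \<xi> * (poisson (?r * \<xi>) \<eta> * T \<eta>) \<partial>circ) = indicator E \<xi> * v (?r * \<xi>)"
          unfolding v_def by (rule integral_mult_right_zero)
        finally show ?case by (simp add: mult.assoc)
      qed
      also have "\<dots> = (\<integral>\<^sup>+\<eta>. (\<integral>\<^sup>+\<xi>. ennreal (indicator E \<xi> * poisson (?r * \<xi>) \<eta> * T \<eta>) \<partial>circ) \<partial>circ)"
        by (rule Fubini') measurable
      also have "\<dots> = (\<integral>\<^sup>+\<eta>. ennreal (c * T \<eta>) \<partial>circ)"
      proof (rule nn_integral_cong_AE, use AE_circ_norm in eventually_elim)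
        case (elim \<eta>)
        have i: "integrable circ (\<lambda>\<xi>. poisson (?r * \<eta>) \<xi> * indicator E \<xi>)"
          by (rule integral_poisson_le(1)[OF r1[OF elim], of _ 1]) (auto simp: indicator_def)
        have "(\<integral>\<^sup>+\<xi>. ennreal (indicator E \<xi> * poisson (?r * \<xi>) \<eta> * T \<eta>) \<partial>circ)
            = (\<integral>\<^sup>+\<xi>. ennreal (poisson (?r * \<eta>) \<xi> * indicator E \<xi> * T \<eta>) \<partial>circ)"
        proof (rule nn_integral_cong_AE, use AE_circ_norm in eventually_elim)
          case (elim \<xi>)
          then show ?case using poisson_swap[OF elim \<open>cmod \<eta> = 1\<close>, of "rad n"] by (simp add: mult.commute)
        qed
        also have "\<dots> = ennreal (\<integral>\<xi>. poisson (?r * \<eta>) \<xi> * indicator E \<xi> * T \<eta> \<partial>circ)"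
          using i poisson_nonneg[OF r1[OF elim]] T(3)
          by (intro nn_integral_eq_integral) auto
        also have "(\<integral>\<xi>. poisson (?r * \<eta>) \<xi> * indicator E \<xi> * T \<eta> \<partial>circ) = c * T \<eta>"
          by (subst integral_mult_left_zero) (simp only: const[OF r1[OF elim]])
        finally show ?case .
      qed
      also have "\<dots> = ennreal (\<integral>\<eta>. c * T \<eta> \<partial>circ)"
        by (rule nn_integral_eq_integral) (use iT T(3) c0 in auto)
      finally show ?thesis
        using nn1 nn2 by (simp only: ennreal_inj)
    qed
    ultimately have "(\<integral>\<xi>. indicator E \<xi> * T \<xi> \<partial>circ) = (\<integral>\<eta>. c * T \<eta> \<partial>circ)"
      by (simp add: LIMSEQ_const_iff)
    then show "(\<integral>x. T x \<partial>density circ (\<lambda>x. ennreal (indicator E x))) = (\<integral>x. T x \<partial>density circ (\<lambda>_. ennreal c))"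
      using c0 by (simp add: integral_real_density del: ennreal_indicator)
  qed simp_all
  \<comment> \<open>On \<open>E\<close> the first measure has mass \<open>c\<close> and the second
    has mass \<open>c * c\<close>.\<close>
  then have "emeasure (density circ (\<lambda>x. ennreal (indicator E x))) E = emeasure (density circ (\<lambda>_. ennreal c)) E" by simp
  moreover have "(\<integral>\<^sup>+x\<in>E. ennreal (indicator E x) \<partial>circ) = (\<integral>\<^sup>+x. indicator E x \<partial>circ)"
    by (intro nn_integral_cong) (auto simp: indicator_def)
  ultimately have "ennreal c = ennreal c * ennreal c"
    by (simp add: emeasure_density nn_integral_cmult c circ.emeasure_eq_measure)
  then have "c = c * c" using c0 by (simp flip: ennreal_mult)
  then show ?thesis by auto
qed

text \<open>The composite of \<open>f\<close> with the Riemann map of \<open>U\<close> is a boundary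
  map into \<open>V\<close> whose radial limits are given by \<open>e\<close>. It and the Riemann
  map of \<open>V\<close> at \<open>f z\<close> have the same value at 0, so
  \<open>boundary_law_completion\<close> with \<open>\<alpha> = 0\<close> and a common
  \<open>E\<close> yields equal measures.\<close>

lemma pullback_harmonic_measure:
  assumes U: "regular_domain U" and V: "regular_domain V" and z: "z \<in> U"
    and f: "f holomorphic_on U" "f ` U \<subseteq> V"
    and e: "AE \<xi> in circ. has_radial_limit (f \<circ> riemann_map_at U z) \<xi> (e (bdry U z \<xi>)) \<and> e (bdry U z \<xi>) \<in> frontier V"
    and A: "harmonic_measurable (f z) A V"
  shows "harmonic_measurable z (e -` A) U" "harmonic_measure z (e -` A) U = harmonic_measure (f z) A V"
proof -
  let ?G = "f \<circ> riemann_map_at U z"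
  have fz: "f z \<in> V" using f(2) z by blast
  note RU = regular_domainD[OF U z] and RV = regular_domainD[OF V fz]
  have sub: "riemann_map_at U z ` ball 0 1 \<subseteq> U" and hol: "riemann_map_at U z holomorphic_on ball 0 1"
    using RU(3) by (auto simp: boundary_map_def)
  have G: "boundary_map V ?G"
    unfolding boundary_map_def
  proof (intro conjI)
    show "?G holomorphic_on ball 0 1" by (rule holomorphic_on_compose_gen[OF hol f(1) sub])
    show "?G ` ball 0 1 \<subseteq> V" using sub f(2) by auto
    show "AE \<xi> in circ. \<exists>p\<in>frontier V. has_radial_limit ?G \<xi> p"
      using e by eventually_elim auto
  qed
  have "AE \<xi> in circ. \<xi> \<in> rlim ?G -` A \<longleftrightarrow> \<xi> \<in> bdry U z -` (e -` A)"
    using e AE_circ_norm by eventually_elim (auto dest: rlim_eq)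
  note eq = sets_measure_completion_cong_AE[OF this]
  obtain E where "E \<in> sets borel" and E: "\<forall>G \<alpha>. boundary_map V G \<and> cmod \<alpha> < 1 \<and> riemann_map_at V (f z) \<alpha> = G 0 \<longrightarrow>
    rlim G -` A \<in> sets (completion circ) \<and>
    measure (completion circ) (rlim G -` A) = (\<integral>\<xi>. poisson \<alpha> \<xi> * indicator E \<xi> \<partial>circ)"
    using boundary_law_completion[OF V fz A] .
  have "?G 0 = f z" using RU(2) by simp
  then show "harmonic_measurable z (e -` A) U" "harmonic_measure z (e -` A) U = harmonic_measure (f z) A V"
    unfolding harmonic_measurable_iff[OF U z] harmonic_measure_eq[OF U z] harmonic_measure_eq[OF V fz]
    using E[rule_format, of ?G 0] E[rule_format, of "riemann_map_at V (f z)" 0] G RV(2,3) eq by auto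
qed

subsection \<open>Orbits and radial extensions\<close>

text \<open>A Koebe-type estimate. Harnack's inequality for the barrier gives
  \<open>Re (q w) \<le> 3 * ln 14\<close>; exponentiating and squaring produce
  \<open>14 ^ 6\<close>, and the triangle inequality through \<open>p\<close> adds 1.\<close>

lemma riemann_map_distortion:
  assumes V: "simply_connected_domain V" and phi: "riemann_map V \<phi>" and w: "cmod w \<le> 1 / 3"
  shows "dist (\<phi> w) (\<phi> 0) \<le> (14 ^ 6 + 1) * infdist (\<phi> 0) (frontier V)"
proof -
  have holo: "\<phi> holomorphic_on ball 0 1" and bij: "bij_betw \<phi> (ball 0 1) V"
    using phi by (auto simp: riemann_map_def)
  have "\<phi> 0 \<in> V" using bij by (auto simp: bij_betw_def)
  then obtain p where p: "p \<notin> V" "ball (\<phi> 0) (dist (\<phi> 0) p) \<subseteq> V"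
    and pd: "dist (\<phi> 0) p = infdist (\<phi> 0) (frontier V)" and pos: "0 < dist (\<phi> 0) p"
    using nearest_frontier_point[OF V] by metis
  define d where "d = dist (\<phi> 0) p"
  have d: "0 < d" using pos by (simp add: d_def)
  obtain q where q: "q holomorphic_on ball 0 1" and qm: "q \<in> borel_measurable borel" and q0: "Re (q 0) = ln 14"
    and le: "\<And>z. cmod z < 1 \<Longrightarrow> ln (1 + sqrt (dist (\<phi> z) p / d)) \<le> Re (q z)"
    using barrier[OF holo bij _ p] unfolding d_def by auto
  have qpos: "0 \<le> Re (q z)" if "cmod z < 1" for z
  proof -
    have "0 \<le> ln (1 + sqrt (dist (\<phi> z) p / d))" using d by (intro ln_ge_zero) simp
    then show ?thesis using le[OF that] by linarith
  qed
  \<comment> \<open>\<open>w\<close> is viewed on the dilation by 2/3, so that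
    \<open>cmod v \<le> 1 / 2\<close> and the kernel is at most 3.\<close>
  define v where "v = (3 / 2) *\<^sub>R w"
  have v: "cmod v \<le> 1 / 2" using w by (simp add: v_def)
  then have v1: "cmod v < 1" by simp
  have wv: "w = of_real (2 / 3) * v" by (simp add: v_def scaleR_conv_of_real)
  have P3: "poisson v \<xi> \<le> 3" if "cmod \<xi> = 1" for \<xi>
  proof -
    have "(1 + cmod v) / (1 - cmod v) \<le> 3" using v by (simp add: field_simps)
    then show ?thesis using poisson_le(1)[OF v1 that] by simp
  qed
  have "Re (q w) = (\<integral>\<xi>. poisson v \<xi> * Re (q (of_real (2 / 3) * \<xi>)) \<partial>circ)"
    unfolding wv by (rule poisson_mean_Re(2)[OF q qm v1, symmetric]) auto
  also have "\<dots> \<le> (\<integral>\<xi>. 3 * (poisson 0 \<xi> * Re (q (of_real (2 / 3) * \<xi>))) \<partial>circ)"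
  proof (rule integral_mono_AE)
    show "integrable circ (\<lambda>\<xi>. poisson v \<xi> * Re (q (of_real (2 / 3) * \<xi>)))"
      by (rule poisson_mean_Re(1)[OF q qm v1]) auto
    show "integrable circ (\<lambda>\<xi>. 3 * (poisson 0 \<xi> * Re (q (of_real (2 / 3) * \<xi>))))"
      by (intro integrable_mult_right poisson_mean_Re(1)[OF q qm]) auto
    show "AE \<xi> in circ. poisson v \<xi> * Re (q (of_real (2 / 3) * \<xi>)) \<le> 3 * (poisson 0 \<xi> * Re (q (of_real (2 / 3) * \<xi>)))"
      using AE_circ_norm
    proof eventually_elim
      case (elim \<xi>)
      have "cmod (of_real (2 / 3) * \<xi>) < 1" unfolding norm_mult norm_of_real using elim by simp
      then show ?case using P3[OF elim] qpos elim by (simp add: mult_right_mono)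
    qed
  qed
  also have "\<dots> = 3 * ln 14"
    using poisson_mean_Re(2)[OF q qm, of 0 "2 / 3"] q0 by simp
  also have "\<dots> = ln (14 ^ 3)" by (subst ln_realpow) auto
  finally have "ln (1 + sqrt (dist (\<phi> w) p / d)) \<le> ln (14 ^ 3)"
    using le[of w] w by simp
  then have "1 + sqrt (dist (\<phi> w) p / d) \<le> 14 ^ 3"
    using d by (subst (asm) ln_le_cancel_iff) (auto intro: add_pos_nonneg)
  then have "sqrt (dist (\<phi> w) p / d) \<le> 14 ^ 3" by simp
  then have "(sqrt (dist (\<phi> w) p / d))\<^sup>2 \<le> (14 ^ 3)\<^sup>2"
    using d by (intro power_mono) auto
  then have "dist (\<phi> w) p \<le> 14 ^ 6 * d" using d by (simp add: field_simps)
  moreover have "dist (\<phi> w) (\<phi> 0) \<le> dist (\<phi> w) p + d" unfolding d_def by (rule dist_triangle2)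
  ultimately show ?thesis by (simp add: d_def pd algebra_simps)
qed

text \<open>\<open>hyp_dist\<close> uses an arbitrarily chosen Riemann map. Recentring it at
  \<open>z0\<close> and lifting through \<open>riemann_map_at V z0\<close> gives a self-map of the
  disc fixing 0, and the Schwarz lemma bounds \<open>cmod w\<close> by the pseudohyperbolic
  distance.\<close>

lemma cmod_le_hyp_dist:
  assumes V: "simply_connected_domain V" and z0: "z0 \<in> V" and w: "cmod w < 1" "riemann_map_at V z0 w = z"
  shows "cmod w \<le> hyp_dist V z z0"
proof -
  define \<phi> where "\<phi> = (SOME \<phi>. riemann_map V \<phi>)"
  let ?\<rho> = "riemann_map_at V z0"
  have \<rho>: "riemann_map V ?\<rho>" "?\<rho> 0 = z0" using riemann_map_at[OF V z0] by auto
  have phi: "riemann_map V \<phi>" unfolding \<phi>_def by (rule someI[of "riemann_map V", OF \<rho>(1)])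
  have z: "z \<in> V" using \<rho>(1) w by (auto simp: riemann_map_def bij_betw_def)
  define a b where "a = inv_into (ball 0 1) \<phi> z" and "b = inv_into (ball 0 1) \<phi> z0"
  have ab: "cmod a < 1" "\<phi> a = z" "cmod b < 1" "\<phi> b = z0"
    using phi z z0 inv_into_into[of _ \<phi> "ball 0 1"] f_inv_into_f[of _ \<phi> "ball 0 1"]
    by (auto simp: riemann_map_def bij_betw_def a_def b_def)
  define m where "m = Moebius_function 0 b a"
  have m1: "cmod m < 1" unfolding m_def using Moebius_function_norm_lt_1[OF ab(3,1)] .
  define G where "G = \<phi> \<circ> Moebius_function 0 (- b)"
  have sub: "Moebius_function 0 (- b) ` ball 0 1 \<subseteq> ball 0 1"
    using Moebius_function_norm_lt_1 ab(3) by auto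
  have G: "G holomorphic_on ball 0 1" "G ` ball 0 1 \<subseteq> V"
    unfolding G_def using phi ab(3) sub
    by (auto intro!: holomorphic_on_compose_gen[OF Moebius_function_holomorphic _ sub]
        simp: riemann_map_def bij_betw_def)
  obtain k where k: "k holomorphic_on ball 0 1" "k \<in> borel_measurable borel"
    "\<And>x. cmod x < 1 \<Longrightarrow> cmod (k x) < 1" "\<And>x. cmod x < 1 \<Longrightarrow> ?\<rho> (k x) = G x"
    using riemann_map_factor[OF \<rho>(1) G] by blast
  have inj: "x = y" if "?\<rho> x = ?\<rho> y" "cmod x < 1" "cmod y < 1" for x y
    using \<rho>(1) that by (auto simp: riemann_map_def bij_betw_def inj_on_def)
  have "G 0 = z0" using ab by (simp add: G_def Moebius_function_of_zero)
  then have "k 0 = 0" using inj[of "k 0" 0] k(3,4)[of 0] \<rho>(2) by simp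
  moreover have "G m = z"
    using Moebius_function_compose[of "- b" b a] ab by (simp add: G_def m_def)
  then have "k m = w" using inj[of "k m" w] k(3,4)[OF m1] w by simp
  ultimately have "cmod w \<le> cmod m"
    using Schwarz_Lemma(1)[OF k(1) _ k(3) m1] by auto
  also have "cmod m = cmod ((a - b) / (1 - cnj b * a))"
    by (simp add: m_def Moebius_function_simple)
  finally have le: "cmod w \<le> cmod ((a - b) / (1 - cnj b * a))" .
  define x where "x = cmod ((a - b) / (1 - cnj b * a))"
  have x: "0 \<le> x" "x < 1" using m1 by (simp_all add: m_def Moebius_function_simple x_def del: norm_divide)
  \<comment> \<open>The pseudohyperbolic distance \<open>x\<close> is now bounded by
    \<open>2 * artanh x\<close>.\<close>
  have "x \<le> - ln (1 - x)" using ln_le_minus_one[of "1 - x"] x by simp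
  also have "\<dots> \<le> ln (1 + x) - ln (1 - x)" using x by simp
  also have "\<dots> = ln ((1 + x) / (1 - x))" using ln_div[of "1 + x" "1 - x"] x by simp
  also have "\<dots> = 2 * artanh x" by (simp add: artanh_def)
  also have "\<dots> = hyp_dist V z z0"
    by (simp only: hyp_dist_def hyp_dist_disc_def a_def b_def \<phi>_def x_def Let_def)
  finally show ?thesis using le unfolding x_def by linarith
qed

text \<open>The image of a radius is itself an admissible arc: injectivity of \<open>\<phi>\<close>
  makes it simple, and a radius approaches its endpoint nontangentially.\<close>

lemma has_radial_extension_radial_limit:
  assumes ext: "has_radial_extension V f p v" and phi: "riemann_map V \<phi>"
    and \<xi>: "cmod \<xi> = 1" and lim: "has_radial_limit \<phi> \<xi> p"
  shows "has_radial_limit (f \<circ> \<phi>) \<xi> v"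
proof -
  let ?s = "\<lambda>t::real. of_real t * \<xi>" and ?\<gamma> = "\<lambda>t::real. \<phi> (of_real t * \<xi>)"
  have s: "?s ` {0..<1} \<subseteq> ball 0 1" using \<xi> by (auto simp: norm_mult)
  have cs: "continuous_on {0..<1} ?s" by (intro continuous_intros)
  have c: "continuous_on (ball 0 1) \<phi>" and bij: "inj_on \<phi> (ball 0 1)" "\<phi> ` ball 0 1 = V"
    using phi by (auto simp: riemann_map_def bij_betw_def holomorphic_on_imp_continuous_on)
  have arc: "half_open_arc_in V ?\<gamma>"
    unfolding half_open_arc_in_def
  proof (intro conjI)
    show "continuous_on {0..<1} ?\<gamma>" by (rule continuous_on_compose2[OF c cs s])
    show "inj_on ?\<gamma> {0..<1}"
    proof (rule inj_onI)
      fix t u :: real assume tu: "t \<in> {0..<1}" "u \<in> {0..<1}" "?\<gamma> t = ?\<gamma> u"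
      then have "?s t = ?s u" using inj_onD[OF bij(1)] s by blast
      then show "t = u" using \<xi> by auto
    qed
    show "?\<gamma> ` {0..<1} \<subseteq> V" using s bij(2) by blast
  qed
  have nt: "nontangential_approach ?s \<xi>"
    unfolding nontangential_approach_def
  \<comment> \<open>Stolz constant 1: on a radius the distance to \<open>\<xi>\<close> equals the
    distance to the circle.\<close>
  proof (intro conjI cs s exI[of _ 1])
    have "(?s \<longlongrightarrow> of_real 1 * \<xi>) (at_left 1)" by (intro tendsto_intros)
    then show "(?s \<longlongrightarrow> \<xi>) (at_left 1)" by simp
    show "\<forall>\<^sub>F t in at_left 1. cmod (?s t - \<xi>) \<le> 1 * (1 - cmod (?s t))"
      using eventually_at_left_real[OF zero_less_one]
    proof eventually_elim
      case (elim t)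
      have "?s t - \<xi> = of_real (t - 1) * \<xi>" by (simp add: algebra_simps)
      then have "cmod (?s t - \<xi>) = \<bar>t - 1\<bar>" using \<xi> by (simp only: norm_mult norm_of_real mult_1_right)
      then show ?case using elim \<xi> by (simp add: norm_mult)
    qed
  qed
  have "approaches_radially V ?\<gamma> p"
    unfolding approaches_radially_def
    using lim phi \<xi> nt by (auto simp: has_radial_limit_def)
  then show ?thesis
    using ext arc unfolding has_radial_extension_def has_radial_limit_def by auto
qed

text \<open>A radius ending at \<open>p\<close> provides an actual arc on which the extension is
  tested, and this pins down its value.\<close>

lemma has_radial_extension_unique:
  assumes "has_radial_extension V f p v" "has_radial_extension V f p v'"
    and "riemann_map V \<phi>" "cmod \<xi> = 1" "has_radial_limit \<phi> \<xi> p"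
  shows "v = v'"
  using has_radial_extension_radial_limit[OF assms(1,3,4,5)] has_radial_extension_radial_limit[OF assms(2,3,4,5)]
  unfolding has_radial_limit_def by (intro tendsto_unique[of "at_left (1::real)"]) auto

lemma full_harmonic_measure_AE:
  assumes "full_harmonic_measure V A" "z \<in> V"
  shows "AE \<xi> in circ. \<exists>p\<in>A. cmod \<xi> = 1 \<and> has_radial_limit (riemann_map_at V z) \<xi> p"
proof -
  let ?E = "radial_preimage (riemann_map_at V z) A"
  interpret C: prob_space "completion circ"
    by (rule prob_spaceI) (simp add: circ.emeasure_space_1)
  have "?E \<in> sets (completion circ)" "measure (completion circ) ?E = 1"
    using assms by (auto simp: full_harmonic_measure_def harmonic_measurable_def harmonic_measure_def circle_measure_eq)
  then have "AE \<xi> in completion circ. \<xi> \<in> ?E"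
    by (simp add: C.prob_eq_1)
  then have "AE \<xi> in circ. \<xi> \<in> ?E" by (simp add: AE_completion_iff)
  then show ?thesis by eventually_elim (auto simp: radial_preimage_def)
qed

lemma harmonic_full_iff:
  assumes "regular_domain V" "z \<in> V"
  shows "harmonic_measurable z A V \<and> harmonic_measure z A V = 1 \<longleftrightarrow> (AE \<xi> in circ. bdry V z \<xi> \<in> A)"
proof -
  interpret C: prob_space "completion circ"
    by (rule prob_spaceI) (simp add: circ.emeasure_space_1)
  have "(AE \<xi> in circ. bdry V z \<xi> \<in> A) \<longleftrightarrow> (AE \<xi> in completion circ. \<xi> \<in> bdry V z -` A)"
    by (simp add: AE_completion_iff)
  also have "\<dots> \<longleftrightarrow> bdry V z -` A \<in> sets (completion circ) \<and> measure (completion circ) (bdry V z -` A) = 1"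
  proof
    assume ae: "AE \<xi> in completion circ. \<xi> \<in> bdry V z -` A"
    have "bdry V z -` A \<in> sets (completion circ)"
      by (rule completion.in_sets_AE[where A = UNIV]) (use ae sets.top[of "completion circ"] in auto)
    then show "bdry V z -` A \<in> sets (completion circ) \<and> measure (completion circ) (bdry V z -` A) = 1"
      using ae by (simp add: C.prob_eq_1)
  qed (use C.prob_eq_1[of "bdry V z -` A"] in simp)
  finally show ?thesis by (simp add: harmonic_measurable_iff[OF assms] harmonic_measure_eq[OF assms])
qed

lemma harmonic_measure_cong_AE:
  assumes V: "regular_domain V" "z \<in> V" and ae: "AE \<xi> in circ. bdry V z \<xi> \<in> A \<longleftrightarrow> bdry V z \<xi> \<in> B"
  shows "harmonic_measurable z A V \<longleftrightarrow> harmonic_measurable z B V" "harmonic_measure z A V = harmonic_measure z B V"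
  using sets_measure_completion_cong_AE[of "bdry V z -` A" "bdry V z -` B" circ] ae
  by (auto simp: harmonic_measurable_iff[OF V] harmonic_measure_eq[OF V])

subsection \<open>The tail sets\<close>

locale boundary_sequence =
  fixes U :: "nat \<Rightarrow> complex set" and f :: "nat \<Rightarrow> complex \<Rightarrow> complex"
  assumes domains: "\<And>n. simply_connected_domain (U n)"
    and holomorphic: "\<And>n. f (Suc n) holomorphic_on U n"
    and maps: "\<And>n. f (Suc n) ` U n \<subseteq> U (Suc n)"
    and boundary: "\<And>n. full_harmonic_measure (U n)
      {\<zeta> \<in> frontier (U n). \<exists>w \<in> frontier (U (Suc n)). has_radial_extension (U n) (f (Suc n)) \<zeta> w}"
begin

definition ext :: "nat \<Rightarrow> complex \<Rightarrow> complex" where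
  "ext n p = (SOME w. w \<in> frontier (U (Suc n)) \<and> has_radial_extension (U n) (f (Suc n)) p w)"

text \<open>At such points the radial extension relation is a function with frontier values, so
  composing relations becomes iterating \<open>ext\<close>.\<close>

definition good :: "nat \<Rightarrow> complex \<Rightarrow> bool" where
  "good n p \<longleftrightarrow> p \<in> frontier (U n) \<and> ext n p \<in> frontier (U (Suc n)) \<and>
     (\<forall>w. has_radial_extension (U n) (f (Suc n)) p w \<longleftrightarrow> w = ext n p)"

primrec ext_seq :: "nat \<Rightarrow> nat \<Rightarrow> complex \<Rightarrow> complex" where
  "ext_seq n 0 p = p"
| "ext_seq n (Suc k) p = ext (n + k) (ext_seq n k p)"

text \<open>Splitting off the first map instead of the last matches inductions that pull sets back
  from level \<open>Suc n\<close> to level \<open>n\<close>.\<close>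

lemma ext_seq_shift: "ext_seq n (Suc k) p = ext_seq (Suc n) k (ext n p)"
  by (induction k) auto

lemma AE_good_limit:
  assumes z: "z \<in> U n"
  shows "AE \<xi> in circ. cmod \<xi> = 1 \<and> has_radial_limit (riemann_map_at (U n) z) \<xi> (bdry (U n) z \<xi>) \<and>
    good n (bdry (U n) z \<xi>)"
  using full_harmonic_measure_AE[OF boundary z]
proof eventually_elim
  case (elim \<xi>)
  then obtain p w where \<xi>: "cmod \<xi> = 1" and p: "p \<in> frontier (U n)" "has_radial_limit (riemann_map_at (U n) z) \<xi> p"
    and w: "w \<in> frontier (U (Suc n))" "has_radial_extension (U n) (f (Suc n)) p w" by auto
  have ext: "ext n p \<in> frontier (U (Suc n)) \<and> has_radial_extension (U n) (f (Suc n)) p (ext n p)"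
    unfolding ext_def by (rule someI) (use w in auto)
  have "v = ext n p" if "has_radial_extension (U n) (f (Suc n)) p v" for v
    using has_radial_extension_unique[OF that conjunct2[OF ext] riemann_map_at(1)[OF domains z] \<xi> p(2)] .
  then show ?case using \<xi> p ext by (auto simp: rlim_eq[OF p(2) \<xi>] good_def)
qed

lemma regular: "regular_domain (U n)"
  unfolding regular_domain_def
proof (intro conjI domains ballI)
  fix z assume z: "z \<in> U n"
  have "AE \<xi> in circ. \<exists>p\<in>frontier (U n). has_radial_limit (riemann_map_at (U n) z) \<xi> p"
    using AE_good_limit[OF z] by eventually_elim (auto simp: good_def)
  then show "boundary_map (U n) (riemann_map_at (U n) z)"
    using riemann_map_at(1)[OF domains z] by (auto simp: boundary_map_def riemann_map_def bij_betw_def)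
qed

lemma pullback:
  assumes z: "z \<in> U n" and A: "harmonic_measurable (f (Suc n) z) A (U (Suc n))"
  shows "harmonic_measurable z (ext n -` A) (U n)"
    "harmonic_measure z (ext n -` A) (U n) = harmonic_measure (f (Suc n) z) A (U (Suc n))"
proof -
  have ae: "AE \<xi> in circ. has_radial_limit (f (Suc n) \<circ> riemann_map_at (U n) z) \<xi> (ext n (bdry (U n) z \<xi>)) \<and>
      ext n (bdry (U n) z \<xi>) \<in> frontier (U (Suc n))"
    using AE_good_limit[OF z]
  proof eventually_elim
    case (elim \<xi>)
    then have *: "has_radial_extension (U n) (f (Suc n)) (bdry (U n) z \<xi>) (ext n (bdry (U n) z \<xi>))"
      and fr: "ext n (bdry (U n) z \<xi>) \<in> frontier (U (Suc n))"
      and \<xi>: "cmod \<xi> = 1" "has_radial_limit (riemann_map_at (U n) z) \<xi> (bdry (U n) z \<xi>)"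
      by (auto simp: good_def)
    show ?case
      using has_radial_extension_radial_limit[OF * riemann_map_at(1)[OF domains z] \<xi>] fr by blast
  qed
  show "harmonic_measurable z (ext n -` A) (U n)"
    "harmonic_measure z (ext n -` A) (U n) = harmonic_measure (f (Suc n) z) A (U (Suc n))"
    using pullback_harmonic_measure[OF regular regular z holomorphic maps ae A] .
qed

lemma maps_in: "z \<in> U n \<Longrightarrow> f (Suc n) z \<in> U (Suc n)"
  using maps by blast

text \<open>Boundary maps preserve harmonic measure, so a set of full measure at level
  \<open>Suc n\<close> pulls back to one at level \<open>n\<close>. This keeps the images of almost
  every point away from the exceptional sets of the later maps.\<close>

lemma AE_good_ext_seq:
  assumes "z \<in> U n"
  shows "AE \<xi> in circ. good (n + k) (ext_seq n k (bdry (U n) z \<xi>))"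
  using assms
proof (induction k arbitrary: n z)
  case 0
  then show ?case using AE_good_limit[OF 0] by (auto elim!: eventually_mono)
next
  case (Suc k)
  let ?A = "{p. good (n + Suc k) (ext_seq (Suc n) k p)}"
  note fz = maps_in[OF Suc.prems]
  have h: "harmonic_measurable (f (Suc n) z) ?A (U (Suc n)) \<and> harmonic_measure (f (Suc n) z) ?A (U (Suc n)) = 1"
    using Suc.IH[OF fz] by (simp add: harmonic_full_iff[OF regular fz])
  then have "harmonic_measurable z (ext n -` ?A) (U n) \<and> harmonic_measure z (ext n -` ?A) (U n) = 1"
    using pullback[OF Suc.prems h[THEN conjunct1]] h by (simp only: simp_thms)
  then show ?case
    unfolding harmonic_full_iff[OF regular Suc.prems] ext_seq_shift by simp
qed

text \<open>\<open>ext\<close> is obtained by choice, so measurability is meant in the completed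
  sense and is pulled back one map at a time.\<close>

lemma harmonic_measurable_ext_seq:
  assumes "z \<in> U n" "B \<in> sets borel"
  shows "harmonic_measurable z (ext_seq n k -` B) (U n)"
  using assms(1)
proof (induction k arbitrary: n z)
  case 0
  have "bdry (U n) z -` B \<in> sets borel"
    using measurable_sets[OF regular_domainD(5)[OF regular 0] assms(2)] by simp
  then show ?case
    unfolding harmonic_measurable_iff[OF regular 0] by (simp add: vimage_def)
next
  case (Suc k)
  have "ext_seq n (Suc k) -` B = ext n -` (ext_seq (Suc n) k -` B)"
    unfolding vimage_def ext_seq_shift by simp
  then show ?case using pullback(1)[OF Suc.prems Suc.IH[OF maps_in[OF Suc.prems]]] by (simp only:)
qed

text \<open>The Denjoy--Wolff set of the sequence from level \<open>n\<close> on, up to null sets in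
  the contracting case and tested against one orbit. The point \<open>z\<close> belongs to level 0,
  hence the index \<open>n + k\<close> on its orbit.\<close>

definition tail_set :: "complex \<Rightarrow> nat \<Rightarrow> complex set" where
  "tail_set z n = {p. (\<lambda>k. ext_seq n k p - comp_seq f (n + k) z) \<longlonglongrightarrow> 0}"

text \<open>Convergence is unaffected by deleting the first term, so tail sets are pulled back to
  one another exactly.\<close>

lemma tail_set_shift: "tail_set z n = ext n -` tail_set z (Suc n)"
proof -
  have "p \<in> tail_set z n \<longleftrightarrow> (\<lambda>k. ext_seq n (Suc k) p - comp_seq f (n + Suc k) z) \<longlonglongrightarrow> 0" for p
    unfolding tail_set_def mem_Collect_eq using filterlim_sequentially_Suc[of "\<lambda>k. ext_seq n k p - comp_seq f (n + k) z"] by simp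
  then show ?thesis unfolding ext_seq_shift by (auto simp: tail_set_def)
qed

lemma harmonic_measurable_tail_set:
  assumes z: "z \<in> U n"
  shows "harmonic_measurable z (tail_set y n) (U n)"
proof -
  let ?B = "\<lambda>j k. cball (comp_seq f (n + k) y) (1 / real (Suc j))"
  \<comment> \<open>Convergence to 0 is written with countable set operations on preimages of closed
    balls, each of which is harmonically measurable.\<close>
  have eq: "tail_set y n = (\<Inter>j. \<Union>m. \<Inter>k\<in>{m..}. ext_seq n k -` ?B j k)"
  proof (intro set_eqI iffI)
    fix p assume "p \<in> tail_set y n"
    then have lim: "(\<lambda>k. ext_seq n k p - comp_seq f (n + k) y) \<longlonglongrightarrow> 0" by (simp add: tail_set_def)
    show "p \<in> (\<Inter>j. \<Union>m. \<Inter>k\<in>{m..}. ext_seq n k -` ?B j k)"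
    proof
      fix j
      have "\<exists>m. \<forall>k\<ge>m. norm (ext_seq n k p - comp_seq f (n + k) y - 0) < 1 / real (Suc j)"
        by (rule LIMSEQ_D[OF lim]) simp
      then show "p \<in> (\<Union>m. \<Inter>k\<in>{m..}. ext_seq n k -` ?B j k)"
        by (force simp: dist_norm norm_minus_commute)
    qed
  next
    fix p assume p: "p \<in> (\<Inter>j. \<Union>m. \<Inter>k\<in>{m..}. ext_seq n k -` ?B j k)"
    have "(\<lambda>k. ext_seq n k p - comp_seq f (n + k) y) \<longlonglongrightarrow> 0"
    proof (rule LIMSEQ_I)
      fix r :: real assume "0 < r"
      then obtain j where j: "1 / real (Suc j) < r" using nat_approx_posE by blast
      from p obtain m where "\<And>k. k \<ge> m \<Longrightarrow> ext_seq n k p \<in> ?B j k" by blast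
      then show "\<exists>m. \<forall>k\<ge>m. norm (ext_seq n k p - comp_seq f (n + k) y - 0) < r"
        using j by (intro exI[of _ m]) (force simp: dist_norm norm_minus_commute)
    qed
    then show "p \<in> tail_set y n" by (simp add: tail_set_def)
  qed
  let ?X = "bdry (U n) z"
  have "?X -` tail_set y n = (\<Inter>j. \<Union>m. \<Inter>k\<in>{m..}. ?X -` (ext_seq n k -` ?B j k))"
    unfolding eq by (simp add: vimage_INT vimage_UN)
  moreover have "?X -` (ext_seq n k -` ?B j k) \<in> sets (completion circ)" for j k
    using harmonic_measurable_ext_seq[OF z, of "?B j k" k]
    unfolding harmonic_measurable_iff[OF regular z] by simp
  ultimately show ?thesis
    unfolding harmonic_measurable_iff[OF regular z] by (auto intro!: sets.countable_INT' sets.countable_UN)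
qed

lemma comp_seq_in: "z \<in> U 0 \<Longrightarrow> comp_seq f n z \<in> U n"
  by (induction n) (use maps_in in auto)

lemma harmonic_measure_tail_set:
  assumes "z \<in> U 0"
  shows "harmonic_measure z (tail_set y 0) (U 0) = harmonic_measure (comp_seq f n z) (tail_set y n) (U n)"
proof (induction n)
  case (Suc n)
  have "harmonic_measure (comp_seq f n z) (tail_set y n) (U n)
      = harmonic_measure (f (Suc n) (comp_seq f n z)) (tail_set y (Suc n)) (U (Suc n))"
    unfolding tail_set_shift[of y n]
    by (intro pullback(2) harmonic_measurable_tail_set maps_in comp_seq_in assms)
  then show ?case using Suc by simp
qed simp

text \<open>A good point lies on the frontier of an open domain, hence outside it, so only the
  boundary alternative of \<open>extended_value\<close> can hold.\<close>

lemma comp_seq_extended_value_iff: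
  assumes "\<And>k. good k (ext_seq 0 k p)"
  shows "comp_seq_extended_value U f n p w \<longleftrightarrow> w = ext_seq 0 n p"
proof (induction n arbitrary: w)
  case (Suc n)
  have g: "good n (ext_seq 0 n p)" by (rule assms)
  have "open (U n)" using domains by (auto simp: simply_connected_domain_def)
  then have "ext_seq 0 n p \<notin> U n" using g by (auto simp: good_def frontier_def interior_open)
  then show ?case using Suc g by (auto simp: extended_value_def good_def)
qed simp

end

section \<open>Contraction and constancy of harmonic measure\<close>

locale contracting_boundary_sequence = boundary_sequence +
  assumes contracting: "contracting U (comp_seq f)"
    and to_boundary: "interior_orbits_converge_to_boundary U (comp_seq f)"
begin

text \<open>In the Riemann maps centred at the orbit of \<open>y\<close>, contraction says that the
  coordinates of the orbit of \<open>z\<close> tend to 0.\<close>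

lemma orbit_coordinates:
  assumes z: "z \<in> U 0" and y: "y \<in> U 0"
  obtains w where "\<And>n. cmod (w n) < 1" "\<And>n. riemann_map_at (U n) (comp_seq f n y) (w n) = comp_seq f n z" "w \<longlonglongrightarrow> 0"
proof -
  have "\<exists>w. cmod w < 1 \<and> riemann_map_at (U n) (comp_seq f n y) w = comp_seq f n z" for n
    using in_domain_riemann_map[OF riemann_map_at(1)[OF domains comp_seq_in[OF y]] comp_seq_in[OF z]] by blast
  then obtain w where w: "\<And>n. cmod (w n) < 1" "\<And>n. riemann_map_at (U n) (comp_seq f n y) (w n) = comp_seq f n z"
    by metis
  have "(\<lambda>n. hyp_dist (U n) (comp_seq f n z) (comp_seq f n y)) \<longlonglongrightarrow> 0"
    using contracting z y by (auto simp: contracting_def)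
  moreover have "cmod (w n) \<le> hyp_dist (U n) (comp_seq f n z) (comp_seq f n y)" for n
    by (rule cmod_le_hyp_dist[OF domains comp_seq_in[OF y] w])
  ultimately have "w \<longlonglongrightarrow> 0"
    by (intro Lim_null_comparison[of w]) auto
  then show ?thesis using that w by blast
qed

text \<open>Once the coordinate has modulus below 1/3, the distortion estimate bounds the Euclidean
  gap by a constant times the distance of the orbit of \<open>y\<close> to the frontier, which tends
  to 0.\<close>

lemma orbits_merge:
  assumes z: "z \<in> U 0" and y: "y \<in> U 0"
  shows "(\<lambda>n. comp_seq f n z - comp_seq f n y) \<longlonglongrightarrow> 0"
proof -
  obtain w where w: "\<And>n. cmod (w n) < 1" "\<And>n. riemann_map_at (U n) (comp_seq f n y) (w n) = comp_seq f n z" "w \<longlonglongrightarrow> 0"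
    using orbit_coordinates[OF assms] by blast
  have "eventually (\<lambda>n. cmod (w n) < 1 / 3) sequentially"
    using tendsto_norm_zero[OF w(3)] by (intro order_tendstoD) auto
  then have "eventually (\<lambda>n. norm (comp_seq f n z - comp_seq f n y)
      \<le> (14 ^ 6 + 1) * infdist (comp_seq f n y) (frontier (U n))) sequentially"
  proof eventually_elim
    case (elim n)
    note R = riemann_map_at[OF domains comp_seq_in[OF y], of n]
    show ?case
      using riemann_map_distortion[OF domains R(1), of "w n"] elim R(2) w(2)[of n] by (simp add: dist_norm)
  qed
  moreover have "(\<lambda>n. infdist (comp_seq f n y) (frontier (U n))) \<longlonglongrightarrow> 0"
    using to_boundary y by (auto simp: interior_orbits_converge_to_boundary_def)
  then have "(\<lambda>n. (14 ^ 6 + 1) * infdist (comp_seq f n y) (frontier (U n))) \<longlonglongrightarrow> 0"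
    by (rule tendsto_mult_right_zero)
  ultimately show ?thesis by (rule Lim_null_comparison)
qed

text \<open>Where all boundary iterates are good, the witness \<open>W\<close> is forced to be
  \<open>ext_seq\<close>. Since orbits merge, the condition for all interior points reduces to the
  one for \<open>y\<close>.\<close>

lemma denjoy_wolff_set_AE:
  assumes z: "z \<in> U 0" and y: "y \<in> U 0"
  shows "AE \<xi> in circ. bdry (U 0) z \<xi> \<in> denjoy_wolff_set U f \<longleftrightarrow> bdry (U 0) z \<xi> \<in> tail_set y 0"
proof -
  have "AE \<xi> in circ. \<forall>k. good k (ext_seq 0 k (bdry (U 0) z \<xi>))"
    using AE_good_ext_seq[OF z] by (simp add: AE_all_countable)
  then show ?thesis
  proof eventually_elim
    case (elim \<xi>)
    let ?p = "bdry (U 0) z \<xi>"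
    have fr: "?p \<in> frontier (U 0)" using elim[rule_format, of 0] by (simp add: good_def)
    have "?p \<in> denjoy_wolff_set U f \<longleftrightarrow>
        (\<forall>x\<in>U 0. (\<lambda>n. cmod (ext_seq 0 n ?p - comp_seq f n x)) \<longlonglongrightarrow> 0)" (is "_ \<longleftrightarrow> ?R")
    proof
      assume "?p \<in> denjoy_wolff_set U f"
      then obtain W where W: "\<And>n. W n = ext_seq 0 n ?p" "\<forall>x\<in>U 0. (\<lambda>n. cmod (W n - comp_seq f n x)) \<longlonglongrightarrow> 0"
        using comp_seq_extended_value_iff[of ?p] elim by (auto simp: denjoy_wolff_set_def)
      then show ?R by simp
    next
      assume ?R
      then show "?p \<in> denjoy_wolff_set U f"
        using comp_seq_extended_value_iff[of ?p] elim fr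
        by (auto simp: denjoy_wolff_set_def intro!: exI[of _ "\<lambda>n. ext_seq 0 n ?p"])
    qed
    also have "\<dots> \<longleftrightarrow> (\<lambda>n. ext_seq 0 n ?p - comp_seq f n y) \<longlonglongrightarrow> 0"
    proof
      assume ?R
      then show "(\<lambda>n. ext_seq 0 n ?p - comp_seq f n y) \<longlonglongrightarrow> 0"
        using y by (auto simp: tendsto_norm_zero_iff)
    next
      assume lim: "(\<lambda>n. ext_seq 0 n ?p - comp_seq f n y) \<longlonglongrightarrow> 0"
      show ?R
      proof
        fix x assume x: "x \<in> U 0"
        have "(\<lambda>n. (ext_seq 0 n ?p - comp_seq f n y) - (comp_seq f n x - comp_seq f n y)) \<longlonglongrightarrow> 0 - 0"
          by (intro tendsto_diff lim orbits_merge x y)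
        then show "(\<lambda>n. cmod (ext_seq 0 n ?p - comp_seq f n x)) \<longlonglongrightarrow> 0"
          by (simp add: tendsto_norm_zero_iff)
      qed
    qed
    finally show ?case by (simp add: tail_set_def)
  qed
qed

text \<open>Both measures can be computed at level \<open>n\<close>, where the poles have
  coordinates \<open>w n\<close> and 0; the Harnack bound on their difference tends to 0.\<close>

lemma harmonic_measure_tail_set_const:
  assumes z: "z \<in> U 0" and y: "y \<in> U 0"
  shows "harmonic_measure z (tail_set y 0) (U 0) = harmonic_measure y (tail_set y 0) (U 0)"
proof -
  obtain w where w: "\<And>n. cmod (w n) < 1" "\<And>n. riemann_map_at (U n) (comp_seq f n y) (w n) = comp_seq f n z" "w \<longlonglongrightarrow> 0"
    using orbit_coordinates[OF assms] by blast
  let ?D = "\<bar>harmonic_measure z (tail_set y 0) (U 0) - harmonic_measure y (tail_set y 0) (U 0)\<bar>"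
  have bound: "?D \<le> 2 * cmod (w n) / (1 - cmod (w n))" for n
    using harmonic_measure_bound[OF regular comp_seq_in[OF y, of n]
        harmonic_measurable_tail_set[OF comp_seq_in[OF y, of n], of y] w(1)[of n]] w(2)[of n] harmonic_measure_tail_set[OF z, of y n] harmonic_measure_tail_set[OF y, of y n]
    by simp
  have lim: "(\<lambda>n. cmod (w n)) \<longlonglongrightarrow> 0"
    by (rule tendsto_norm_zero[OF w(3)])
  have "(\<lambda>n. 2 * cmod (w n) / (1 - cmod (w n))) \<longlonglongrightarrow> 2 * 0 / (1 - 0)"
    by (rule tendsto_divide[OF tendsto_mult_left[OF lim] tendsto_diff[OF tendsto_const lim]]) simp
  then have "?D \<le> 2 * 0 / (1 - 0)"
    by (rule LIMSEQ_le_const) (use bound in blast)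
  then show ?thesis by simp
qed

text \<open>The tail set, equal to the Denjoy--Wolff set almost everywhere, has measure independent
  of the pole. This makes the Poisson integral of an indicator constant, so its value is 0 or
  1.\<close>

lemma harmonic_measure_denjoy_wolff_set:
  assumes y: "y \<in> U 0"
  shows "\<exists>c\<in>{0, 1}. \<forall>z\<in>U 0. harmonic_measurable z (denjoy_wolff_set U f) (U 0) \<and>
    harmonic_measure z (denjoy_wolff_set U f) (U 0) = c"
proof -
  define c where "c = harmonic_measure y (tail_set y 0) (U 0)"
  have "harmonic_measurable z (denjoy_wolff_set U f) (U 0) \<and> harmonic_measure z (denjoy_wolff_set U f) (U 0) = c"
    if z: "z \<in> U 0" for z
    using harmonic_measure_cong_AE[OF regular z denjoy_wolff_set_AE[OF z y]]
      harmonic_measurable_tail_set[OF z, of y] harmonic_measure_tail_set_const[OF z y] by (simp add: c_def)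
  moreover have "c = 0 \<or> c = 1"
  proof -
    obtain E where E: "E \<in> sets borel" "\<forall>\<alpha>. cmod \<alpha> < 1 \<longrightarrow>
      harmonic_measurable (riemann_map_at (U 0) y \<alpha>) (tail_set y 0) (U 0) \<and>
      harmonic_measure (riemann_map_at (U 0) y \<alpha>) (tail_set y 0) (U 0) = (\<integral>\<xi>. poisson \<alpha> \<xi> * indicator E \<xi> \<partial>circ)"
      using harmonic_measure_poisson[OF regular y harmonic_measurable_tail_set[OF y]] .
    show ?thesis
    proof (rule constant_poisson_integral_zero_one[OF E(1)])
      fix \<alpha> :: complex assume \<alpha>: "cmod \<alpha> < 1"
      then have "riemann_map_at (U 0) y \<alpha> \<in> U 0"
        using riemann_map_at(1)[OF domains y] by (auto simp: riemann_map_def bij_betw_def)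
      then show "(\<integral>\<xi>. poisson \<alpha> \<xi> * indicator E \<xi> \<partial>circ) = c"
        using E(2)[rule_format, OF \<alpha>] harmonic_measure_tail_set_const[OF _ y] unfolding c_def by metis
    qed
  qed
  ultimately show ?thesis by blast
qed

end

theorem theoremF:
  fixes U :: "nat \<Rightarrow> complex set" and f :: "nat \<Rightarrow> complex \<Rightarrow> complex"
  assumes domains: "\<And>n. simply_connected_domain (U n)"
    and holomorphic: "\<And>n. f (Suc n) holomorphic_on U n"
    and maps: "\<And>n. f (Suc n) ` U n \<subseteq> U (Suc n)"
    and extension: "\<And>n. full_radial_extension (U n) (f (Suc n))"
    and boundary: "\<And>n. full_harmonic_measure (U n)
      {\<zeta> \<in> frontier (U n). \<exists>w \<in> frontier (U (Suc n)). has_radial_extension (U n) (f (Suc n)) \<zeta> w}"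
    and contracting: "contracting U (comp_seq f)"
    and to_boundary: "interior_orbits_converge_to_boundary U (comp_seq f)"
  shows "full_harmonic_measure (U 0) (denjoy_wolff_set U f) \<or>
         zero_harmonic_measure (U 0) (denjoy_wolff_set U f)"
proof -
  interpret contracting_boundary_sequence U f
    by unfold_locales (fact domains holomorphic maps boundary contracting to_boundary)+
  obtain y where "y \<in> U 0" using domains[of 0] by (auto simp: simply_connected_domain_def)
  from harmonic_measure_denjoy_wolff_set[OF this] show ?thesis
    by (auto simp: full_harmonic_measure_def zero_harmonic_measure_def)
qed

end
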